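(* Let $n\ge 1$ and let $\beta'$ be an $n$-braid given by a braid word of length $c$ with exactly $\ell$ negative crossings, where $0\le \ell\le n$. Let $\beta=\Delta_n^2\,\beta'\in B_n$, where $\Delta_n^2$ is the positive full twist in $B_n$, and let $\overline{\beta}$ be the closure of $\beta$. Then there exist polynomials $p(\overline\beta;t)$ and $q(\overline\beta;t)$ in $t$ such that $$V_{\overline{\beta}}(t)=(-1)^{n+c+1}\,t^{\frac{(n-1)^2+c-2\ell}{2}}\left(\frac{1+t^{\,n-\ell+1}\,p(\overline\beta;t)}{1-t^2}\right)$$ and $$V_{\overline{\beta}}(t)=(-1)^{n+c+1}\,t^{\frac{(n-1)^2+c-2\ell}{2}}\left(\sum_{i=0}^{\lfloor (n-\ell)/2\rfloor}t^{2i}+t^{\,n-\ell+1}\,q(\overline\beta;t)\right).$$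
   Context: $B_n$ is the braid group on $n$ strands with standard generators $\sigma_1,\dots,\sigma_{n-1}$, each $\sigma_i$ being a positive crossing and each $\sigma_i^{-1}$ a negative crossing when the strands are oriented in parallel. The length of a braid word is its number of letters $\sigma_i^{\pm1}$. The positive full twist is $\Delta_n^2=(\sigma_1\sigma_2\cdots\sigma_{n-1})^n$. Closed braids are oriented by orienting all strands in parallel. $V_L(t)$ is the Jones polynomial of an oriented link $L$, normalized by $t^{-1}V_{L_+}-tV_{L_-}=(t^{1/2}-t^{-1/2})V_{L_0}$ (where $L_+,L_-$ have a positive, resp. negative, crossing at a given place and $L_0$ is the oriented smoothing) and $V_{\bigcirc}(t)=1$ for the unknot $\bigcirc$. $\lfloor\cdot\rfloor$ denotes the integer part. *)

theory Defs
  imports "HOL-Computational_Algebra.Formal_Laurent_Series"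
begin

section \<open>Oriented link diagrams\<close>

text \<open>
  Oriented tangle diagrams are given in sliced form, that is, as words in the generators of
  the category of oriented tangles (Turaev, Operator invariants of tangles, and R-matrices;
  Kassel, Quantum Groups, Chapters X and XII). A diagram is read from bottom to top. At a
  generic height it meets a finite sequence of strands, each directed up or down. A slice
  \<open>(a, g, b)\<close> is the elementary diagram \<open>g\<close> with vertical strands \<open>a\<close> on its left and \<open>b\<close> on
  its right. Both strands of a crossing are directed upwards; every oriented link has such a
  diagram, since the other crossings can be turned with cups and caps.
\<close>

datatype orient = Up | Down

fun opp :: "orient \<Rightarrow> orient" where
  "opp Up = Down"
| "opp Down = Up"

text \<open>
  In \<open>PosX\<close> the strand from bottom left to top right runs over the other one, in \<open>NegX\<close> under
  it. \<open>Cup e\<close> is the minimum whose left end is directed by \<open>e\<close>, and \<open>Cap e\<close> the maximum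
  whose left end is directed by \<open>e\<close>.
\<close>

datatype gen = PosX | NegX | Cup orient | Cap orient

fun gen_dom :: "gen \<Rightarrow> orient list" where
  "gen_dom PosX = [Up, Up]"
| "gen_dom NegX = [Up, Up]"
| "gen_dom (Cup e) = []"
| "gen_dom (Cap e) = [e, opp e]"

fun gen_cod :: "gen \<Rightarrow> orient list" where
  "gen_cod PosX = [Up, Up]"
| "gen_cod NegX = [Up, Up]"
| "gen_cod (Cup e) = [e, opp e]"
| "gen_cod (Cap e) = []"

type_synonym slice = "orient list \<times> gen \<times> orient list"

fun slice_dom :: "slice \<Rightarrow> orient list" where
  "slice_dom (a, g, b) = a @ gen_dom g @ b"

fun slice_cod :: "slice \<Rightarrow> orient list" where
  "slice_cod (a, g, b) = a @ gen_cod g @ b"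

fun tangle_diagram :: "orient list \<Rightarrow> slice list \<Rightarrow> orient list \<Rightarrow> bool" where
  "tangle_diagram u [] v \<longleftrightarrow> u = v"
| "tangle_diagram u (s # D) v \<longleftrightarrow> slice_dom s = u \<and> tangle_diagram (slice_cod s) D v"

definition link_diagram :: "slice list \<Rightarrow> bool" where
  "link_diagram D \<longleftrightarrow> tangle_diagram [] D []"

definition unknot_diagram :: "slice list" where
  "unknot_diagram = [([], Cup Up, []), ([], Cap Up, [])]"


section \<open>Isotopy of oriented links\<close>

text \<open>
  The local moves are Turaev's defining relations of the category of oriented tangles:
  moving distant elementary diagrams past each other, straightening a zigzag, turning a
  crossing upside down in the two possible ways, and the three Reidemeister moves, where
  Reidemeister's second move occurs for parallel (\<open>R2\<close>) and for antiparallel strands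
  (\<open>R2_side\<close>). The remaining oriented versions of the Reidemeister moves follow from these.
\<close>

inductive local_move :: "slice list \<Rightarrow> slice list \<Rightarrow> bool" where
  exchange: "local_move
     [([], g, b @ gen_dom h), (gen_cod g @ b, h, [])]
     [(gen_dom g @ b, h, []), ([], g, b @ gen_cod h)]"
| zigzag_right: "local_move [([], Cup e, [e]), ([e], Cap (opp e), [])] []"
| zigzag_left: "local_move [([e], Cup (opp e), []), ([], Cap e, [e])] []"
| rotate: "x \<in> {PosX, NegX} \<Longrightarrow> local_move
     [([Down, Down], Cup Up, []), ([Down, Down, Up], Cup Up, [Down]),
      ([Down, Down], x, [Down, Down]),
      ([Down], Cap Down, [Up, Down, Down]), ([], Cap Down, [Down, Down])]
     [([], Cup Down, [Down, Down]), ([Down], Cup Down, [Up, Down, Down]),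
      ([Down, Down], x, [Down, Down]),
      ([Down, Down, Up], Cap Up, [Down]), ([Down, Down], Cap Up, [])]"
| R1: "x \<in> {PosX, NegX} \<Longrightarrow> local_move
     [([Up], Cup Up, []), ([], x, [Down]), ([Up], Cap Up, [])] []"
| R2: "(x, y) \<in> {(PosX, NegX), (NegX, PosX)} \<Longrightarrow> local_move
     [([], x, []), ([], y, [])] []"
| R2_side_up_down: "(x, y) \<in> {(PosX, NegX), (NegX, PosX)} \<Longrightarrow> local_move
     [([], Cup Down, [Up, Down]), ([Down], x, [Down]), ([Down, Up], Cap Up, []),
      ([Down, Up], Cup Up, []), ([Down], y, [Down]), ([], Cap Down, [Up, Down])] []"
| R2_side_down_up: "(x, y) \<in> {(PosX, NegX), (NegX, PosX)} \<Longrightarrow> local_move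
     [([Down, Up], Cup Up, []), ([Down], x, [Down]), ([], Cap Down, [Up, Down]),
      ([], Cup Down, [Up, Down]), ([Down], y, [Down]), ([Down, Up], Cap Up, [])] []"
| R3: "local_move
     [([], PosX, [Up]), ([Up], PosX, []), ([], PosX, [Up])]
     [([Up], PosX, []), ([], PosX, [Up]), ([Up], PosX, [])]"

definition whisker :: "orient list \<Rightarrow> orient list \<Rightarrow> slice list \<Rightarrow> slice list" where
  "whisker a b D = map (\<lambda>(u, g, v). (a @ u, g, v @ b)) D"

text \<open>
  Requiring both sides to be link diagrams makes the replacement well typed even when one
  side of the local move is the empty list, which stands for vertical strands.
\<close>

definition link_move :: "slice list \<Rightarrow> slice list \<Rightarrow> bool" where
  "link_move D D' \<longleftrightarrow> link_diagram D \<and> link_diagram D' \<and>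
     (\<exists>A B a b L R. local_move L R \<and>
        D = A @ whisker a b L @ B \<and> D' = A @ whisker a b R @ B)"

definition isotopic :: "slice list \<Rightarrow> slice list \<Rightarrow> bool" where
  "isotopic = equivclp link_move"


section \<open>The Jones polynomial\<close>

text \<open>
  The indeterminate \<open>t\<^sup>1\<^sup>/\<^sup>2\<close> is the variable of the field of formal Laurent series, which
  contains the Laurent polynomials in \<open>t\<^sup>1\<^sup>/\<^sup>2\<close> with integer coefficients and in which one
  can divide by \<open>1 - t\<^sup>2\<close>.
\<close>

definition t_half :: "rat fls" where
  "t_half = fls_X"

definition t_var :: "rat fls" where
  "t_var = t_half ^ 2"

definition eval_t :: "int poly \<Rightarrow> rat fls" where
  "eval_t p = poly (map_poly of_int p) t_var"

text \<open>
  The Jones polynomial as a function of diagrams: an isotopy invariant of oriented links with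
  value 1 on the unknot that satisfies the skein relation. In the skein relation,
  \<open>L\<^sub>0\<close> is obtained by deleting the crossing slice, since both strands are directed upwards.
  These properties determine the value on every nonempty link diagram; nothing is required of \<open>V\<close> on
  lists of slices that are not link diagrams.
\<close>

definition jones_polynomial :: "(slice list \<Rightarrow> rat fls) \<Rightarrow> bool" where
  "jones_polynomial V \<longleftrightarrow>
     (\<forall>D D'. link_diagram D \<and> link_diagram D' \<and> isotopic D D' \<longrightarrow> V D = V D') \<and>
     V unknot_diagram = 1 \<and>
     (\<forall>A B a b. link_diagram (A @ [(a, PosX, b)] @ B) \<longrightarrow>
        inverse t_var * V (A @ [(a, PosX, b)] @ B) - t_var * V (A @ [(a, NegX, b)] @ B)
          = (t_half - inverse t_half) * V (A @ B))"


section \<open>Closed braids\<close>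

text \<open>
  \<open>Sigma i\<close> and \<open>SigmaInv i\<close> stand for the generator of index \<open>i\<close> and its inverse, where
  \<open>1 \<le> i < n\<close> in the braid group on \<open>n\<close> strands; products are stacked from bottom to top.
\<close>

datatype braid_letter = Sigma nat | SigmaInv nat

fun letter_index :: "braid_letter \<Rightarrow> nat" where
  "letter_index (Sigma i) = i"
| "letter_index (SigmaInv i) = i"

fun letter_crossing :: "braid_letter \<Rightarrow> gen" where
  "letter_crossing (Sigma i) = PosX"
| "letter_crossing (SigmaInv i) = NegX"

fun is_negative :: "braid_letter \<Rightarrow> bool" where
  "is_negative (Sigma i) = False"
| "is_negative (SigmaInv i) = True"

definition braid_word :: "nat \<Rightarrow> braid_letter list \<Rightarrow> bool" where
  "braid_word n w \<longleftrightarrow> (\<forall>x \<in> set w. 1 \<le> letter_index x \<and> letter_index x < n)"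

definition negative_crossings :: "braid_letter list \<Rightarrow> nat" where
  "negative_crossings w = length (filter is_negative w)"

definition full_twist :: "nat \<Rightarrow> braid_letter list" where
  "full_twist n = concat (replicate n (map Sigma [1..<n]))"

text \<open>
  The \<open>n\<close> strands of the braid are directed upwards and are closed by \<open>n\<close> nested parallel
  arcs running downwards on the right.
\<close>

definition letter_slice :: "nat \<Rightarrow> braid_letter \<Rightarrow> slice" where
  "letter_slice n x =
     (replicate (letter_index x - 1) Up, letter_crossing x,
      replicate (n - 1 - letter_index x) Up @ replicate n Down)"

definition braid_closure :: "nat \<Rightarrow> braid_letter list \<Rightarrow> slice list" where
  "braid_closure n w =
     map (\<lambda>k. (replicate k Up, Cup Up, replicate k Down)) [0..<n] @
     map (letter_slice n) w @
     map (\<lambda>k. (replicate k Up, Cap Up, replicate k Down)) (rev [0..<n])"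

lemma tangle_diagram_append:
  "tangle_diagram u (D @ E) v \<longleftrightarrow> (\<exists>m. tangle_diagram u D m \<and> tangle_diagram m E v)"
  by (induction u D v rule: tangle_diagram.induct) auto

lemma link_diagram_braid_closure:
  assumes "braid_word n w"
  shows "link_diagram (braid_closure n w)"
proof -
  have cups: "tangle_diagram [] (map (\<lambda>k. (replicate k Up, Cup Up, replicate k Down)) [0..<n])
      (replicate n Up @ replicate n Down)"
    by (induction n) (auto simp: tangle_diagram_append replicate_append_same[symmetric])
  have caps: "tangle_diagram (replicate n Up @ replicate n Down)
      (map (\<lambda>k. (replicate k Up, Cap Up, replicate k Down)) (rev [0..<n])) []"
    by (induction n) (auto simp: replicate_append_same[symmetric])
  have word: "tangle_diagram (replicate n Up @ replicate n Down) (map (letter_slice n) w)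
      (replicate n Up @ replicate n Down)"
    using assms
  proof (induction w)
    case (Cons x w)
    have "1 \<le> letter_index x" "letter_index x < n"
      using Cons.prems by (auto simp: braid_word_def)
    then obtain i j where ij: "letter_index x = Suc i" "n = i + 2 + j"
      using less_imp_Suc_add[of "letter_index x" n] by (cases "letter_index x") auto
    have strands: "replicate i Up @ Up # Up # replicate j Up @ xs = replicate n Up @ xs" for xs
      by (simp add: ij(2) replicate_add numeral_2_eq_2 replicate_app_Cons_same)
    have crossing: "gen_dom (letter_crossing x) = [Up, Up]" "gen_cod (letter_crossing x) = [Up, Up]"
      by (cases x; simp)+
    have "letter_slice n x = (replicate i Up, letter_crossing x, replicate j Up @ replicate n Down)"
      using ij by (simp add: letter_slice_def)
    then have "slice_dom (letter_slice n x) = replicate n Up @ replicate n Down"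
      "slice_cod (letter_slice n x) = replicate n Up @ replicate n Down"
      by (simp_all add: crossing strands)
    then show ?case
      using Cons by (simp add: braid_word_def)
  qed simp
  show ?thesis
    unfolding link_diagram_def braid_closure_def tangle_diagram_append
    using cups word caps by blast
qed

end

theory Submission
  imports Defs
begin

text \<open>
  On closures of braids on \<open>n\<close> strands the Jones polynomial is, up to normalization, a functional
  on the Hecke algebra with \<open>F\<^sub>n\<^sub>+\<^sub>1 (x g\<^sub>n y) = F\<^sub>n (x y)\<close>, and such a family is unique. It is therefore
  given by the quantum trace of the R-matrix representation on \<open>V\<^sup>\<otimes>\<^sup>n\<close>, scaled so that
  the generators are \<open>g = 1 - u\<close> with \<open>u = cup \<circ> cap\<close>, and \<open>t g\<^sup>-\<^sup>1 = t - u\<close>.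

  Pulling a cup through the full twist removes two strands and leaves the scalar \<open>t\<^sup>n\<close>. Hence
  modulo \<open>t\<^sup>n\<close> the full twist kills all images of cups, so that \<open>t\<^sup>\<ell> \<beta>'\<close> may be replaced by
  \<open>t\<^sup>\<ell>\<close>, and each weight space, which has rank one modulo these images, contributes \<open>1\<close> to
  the trace of the full twist. The weight \<open>k\<close> occurs with the factor \<open>t\<^sup>k\<close>, and the weight \<open>0\<close>
  is computed exactly. So \<open>t\<^sup>\<ell>\<close> times the trace is \<open>t\<^sup>\<ell> (1 + t + \<dots> + t\<^sup>n)\<close> modulo
  \<open>t\<^sup>n\<^sup>+\<^sup>1\<close>, and dividing by the value \<open>1 + t\<close> of the unknot gives the claim.
\<close>


section \<open>Diagram moves on closed braids\<close>

lemma tangle_diagram_replace: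
  assumes "link_diagram (A @ L @ B)"
    and "\<And>u v. tangle_diagram u L v \<Longrightarrow> tangle_diagram u R v"
  shows "link_diagram (A @ R @ B)"
  using assms unfolding link_diagram_def tangle_diagram_append by blast

text \<open>An empty \<open>R\<close> does not record its strands, so the last hypothesis provides
  that the replacement is again well typed.\<close>

lemma jones_local_move:
  assumes "jones_polynomial V" "local_move L R" "link_diagram (A @ whisker a b L @ B)"
    and "\<And>u v. tangle_diagram u (whisker a b L) v \<Longrightarrow> tangle_diagram u (whisker a b R) v"
  shows "V (A @ whisker a b L @ B) = V (A @ whisker a b R @ B)"
proof -
  have link: "link_diagram (A @ whisker a b R @ B)"
    using tangle_diagram_replace assms(3,4) by blast
  then have "link_move (A @ whisker a b L @ B) (A @ whisker a b R @ B)"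
    using assms(2,3) unfolding link_move_def by blast
  then have "isotopic (A @ whisker a b L @ B) (A @ whisker a b R @ B)"
    unfolding isotopic_def by (auto simp: equivclp_def symclp_def)
  then show ?thesis
    using assms(1,3) link unfolding jones_polynomial_def by blast
qed

lemma jones_exchange:
  assumes "jones_polynomial V"
    and "link_diagram (A @ [(a, g, b @ gen_dom h @ c), (a @ gen_cod g @ b, h, c)] @ B)"
  shows "V (A @ [(a, g, b @ gen_dom h @ c), (a @ gen_cod g @ b, h, c)] @ B) =
    V (A @ [(a @ gen_dom g @ b, h, c), (a, g, b @ gen_cod h @ c)] @ B)"
  using jones_local_move[OF assms(1) exchange[of g b h], of A a c B] assms(2)
  by (simp add: whisker_def)

section \<open>Sliding the innermost strand of the closure, and Markov stabilization\<close>

definition cups :: "nat \<Rightarrow> slice list" where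
  "cups n = map (\<lambda>k. (replicate k Up, Cup Up, replicate k Down)) [0..<n]"

definition caps :: "nat \<Rightarrow> slice list" where
  "caps n = map (\<lambda>k. (replicate k Up, Cap Up, replicate k Down)) (rev [0..<n])"

lemma braid_closure_eq: "braid_closure n w = cups n @ map (letter_slice n) w @ caps n"
  by (simp add: braid_closure_def cups_def caps_def)

lemma cups_Suc: "cups (Suc n) = cups n @ [(replicate n Up, Cup Up, replicate n Down)]"
  by (simp add: cups_def)

lemma caps_Suc: "caps (Suc n) = (replicate n Up, Cap Up, replicate n Down) # caps n"
  by (simp add: caps_def)

lemma braid_word_append [simp]:
  "braid_word n (v @ w) \<longleftrightarrow> braid_word n v \<and> braid_word n w"
  by (auto simp: braid_word_def)

lemma braid_word_Cons [simp]:
  "braid_word n (x # w) \<longleftrightarrow> 1 \<le> letter_index x \<and> letter_index x < n \<and> braid_word n w"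
  by (auto simp: braid_word_def)

lemma braid_word_Nil [simp]: "braid_word n []"
  by (simp add: braid_word_def)

lemma braid_word_mono: "braid_word n w \<Longrightarrow> n \<le> m \<Longrightarrow> braid_word m w"
  by (auto simp: braid_word_def)

lemma letter_crossing_type [simp]:
  "gen_dom (letter_crossing x) = [Up, Up]" "gen_cod (letter_crossing x) = [Up, Up]"
  by (cases x; simp)+

text \<open>Makes the strands beside the crossing explicit: the innermost cup or cap only adds or
  removes \<open>[Up, Down]\<close> to its right, which is the form that \<open>exchange\<close>
  needs.\<close>

lemma letter_slice_strands:
  assumes "1 \<le> letter_index x" "letter_index x < n"
  obtains i j where "\<And>zs. replicate i Up @ Up # Up # replicate j Up @ zs = replicate n Up @ zs"
    and "letter_slice n x = (replicate i Up, letter_crossing x, replicate j Up @ replicate n Down)"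
    and "letter_slice (Suc n) x =
      (replicate i Up, letter_crossing x, replicate j Up @ [Up, Down] @ replicate n Down)"
proof -
  obtain i j where ij: "letter_index x = Suc i" "n = i + 2 + j"
    using assms less_imp_Suc_add[of "letter_index x" n] by (cases "letter_index x") auto
  show thesis
    by (rule that[of i j])
      (simp_all add: letter_slice_def ij replicate_add numeral_2_eq_2 replicate_app_Cons_same)
qed

lemma jones_slide_cup:
  assumes "jones_polynomial V" "1 \<le> letter_index x" "letter_index x < n"
    and "link_diagram (A @ [letter_slice n x, (replicate n Up, Cup Up, replicate n Down)] @ B)"
  shows "V (A @ [letter_slice n x, (replicate n Up, Cup Up, replicate n Down)] @ B) =
    V (A @ [(replicate n Up, Cup Up, replicate n Down), letter_slice (Suc n) x] @ B)"
proof -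
  obtain i j where ups: "\<And>zs. replicate i Up @ Up # Up # replicate j Up @ zs = replicate n Up @ zs"
    and s: "letter_slice n x = (replicate i Up, letter_crossing x, replicate j Up @ replicate n Down)"
    "letter_slice (Suc n) x =
      (replicate i Up, letter_crossing x, replicate j Up @ [Up, Down] @ replicate n Down)"
    using letter_slice_strands[OF assms(2,3)] by blast
  show ?thesis
    using jones_exchange[OF assms(1), of A "replicate i Up" "letter_crossing x" "replicate j Up"
        "Cup Up" "replicate n Down" B] assms(4)
    by (simp add: s ups[of "[]", simplified])
qed

lemma jones_slide_cap:
  assumes "jones_polynomial V" "1 \<le> letter_index x" "letter_index x < n"
    and "link_diagram (A @ [letter_slice (Suc n) x, (replicate n Up, Cap Up, replicate n Down)] @ B)"
  shows "V (A @ [letter_slice (Suc n) x, (replicate n Up, Cap Up, replicate n Down)] @ B) =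
    V (A @ [(replicate n Up, Cap Up, replicate n Down), letter_slice n x] @ B)"
proof -
  obtain i j where ups: "\<And>zs. replicate i Up @ Up # Up # replicate j Up @ zs = replicate n Up @ zs"
    and s: "letter_slice n x = (replicate i Up, letter_crossing x, replicate j Up @ replicate n Down)"
    "letter_slice (Suc n) x =
      (replicate i Up, letter_crossing x, replicate j Up @ [Up, Down] @ replicate n Down)"
    using letter_slice_strands[OF assms(2,3)] by blast
  show ?thesis
    using jones_exchange[OF assms(1), of A "replicate i Up" "letter_crossing x" "replicate j Up"
        "Cap Up" "replicate n Down" B] assms(4)
    by (simp add: s ups[of "[]", simplified])
qed

text \<open>
  The innermost strand of the closure does not meet \<open>v\<close> and \<open>w\<close>, so its minimum slides up
  past \<open>v\<close> and its maximum slides down past \<open>w\<close>, until they isolate a kink.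
\<close>

lemma jones_stabilization:
  assumes V: "jones_polynomial V" and x: "letter_index x = Suc n"
    and vw: "braid_word (Suc n) v" "braid_word (Suc n) w"
  shows "V (braid_closure (Suc (Suc n)) (v @ x # w)) = V (braid_closure (Suc n) (v @ w))"
proof -
  define m where "m = Suc n"
  define cup :: slice where "cup = (replicate m Up, Cup Up, replicate m Down)"
  define cap :: slice where "cap = (replicate m Up, Cap Up, replicate m Down)"
  \<comment> \<open>Typing is carried through the induction because each exchange is made between
    link diagrams.\<close>
  have cup: "link_diagram (A @ map (letter_slice m) v @ [cup] @ B) \<and>
      V (A @ [cup] @ map (letter_slice (Suc m)) v @ B) = V (A @ map (letter_slice m) v @ [cup] @ B)"
    if "link_diagram (A @ [cup] @ map (letter_slice (Suc m)) v @ B)" for A B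
    using vw(1) that
  proof (induction v arbitrary: A)
    case (Cons y v)
    have y: "1 \<le> letter_index y" "letter_index y < m"
      using Cons.prems(1) by (auto simp: m_def)
    obtain i j where ups: "\<And>zs. replicate i Up @ Up # Up # replicate j Up @ zs = replicate m Up @ zs"
      and s: "letter_slice m y = (replicate i Up, letter_crossing y, replicate j Up @ replicate m Down)"
      "letter_slice (Suc m) y =
        (replicate i Up, letter_crossing y, replicate j Up @ [Up, Down] @ replicate m Down)"
      using letter_slice_strands[OF y] by blast
    let ?C = "map (letter_slice (Suc m)) v @ B"
    have "link_diagram (A @ [letter_slice m y, cup] @ ?C)"
      by (rule tangle_diagram_replace[where L = "[cup, letter_slice (Suc m) y]"])
        (use Cons.prems(2) in \<open>auto simp: s cup_def ups\<close>)
    moreover from this have "V (A @ [letter_slice m y, cup] @ ?C) =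
        V (A @ [cup, letter_slice (Suc m) y] @ ?C)"
      unfolding cup_def by (intro jones_slide_cup[OF V y])
    ultimately show ?case
      using Cons.IH[of "A @ [letter_slice m y]"] Cons.prems(1) by simp
  qed simp
  have cap: "link_diagram (A @ [cap] @ map (letter_slice m) w @ B) \<and>
      V (A @ map (letter_slice (Suc m)) w @ [cap] @ B) = V (A @ [cap] @ map (letter_slice m) w @ B)"
    if "link_diagram (A @ map (letter_slice (Suc m)) w @ [cap] @ B)" for A B
    using vw(2) that
  proof (induction w arbitrary: B rule: rev_induct)
    case (snoc y w)
    have y: "1 \<le> letter_index y" "letter_index y < m"
      using snoc.prems(1) by (auto simp: m_def)
    obtain i j where ups: "\<And>zs. replicate i Up @ Up # Up # replicate j Up @ zs = replicate m Up @ zs"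
      and s: "letter_slice m y = (replicate i Up, letter_crossing y, replicate j Up @ replicate m Down)"
      "letter_slice (Suc m) y =
        (replicate i Up, letter_crossing y, replicate j Up @ [Up, Down] @ replicate m Down)"
      using letter_slice_strands[OF y] by blast
    let ?C = "A @ map (letter_slice (Suc m)) w"
    have "link_diagram (?C @ [cap, letter_slice m y] @ B)"
      by (rule tangle_diagram_replace[where L = "[letter_slice (Suc m) y, cap]"])
        (use snoc.prems(2) in \<open>auto simp: s cap_def ups ups[where zs = "[]", simplified]\<close>)
    moreover have "V (?C @ [letter_slice (Suc m) y, cap] @ B) =
        V (?C @ [cap, letter_slice m y] @ B)"
      unfolding cap_def by (intro jones_slide_cap[OF V y])
        (use snoc.prems(2) in \<open>simp add: cap_def\<close>)
    ultimately show ?case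
      using snoc.IH[of "[letter_slice m y] @ B"] snoc.prems(1) by simp
  qed simp
  have slice: "letter_slice (Suc m) x = (replicate n Up, letter_crossing x, Down # replicate m Down)"
    using x by (simp add: letter_slice_def m_def)
  let ?A = "cups m @ map (letter_slice m) v" and ?B = "map (letter_slice m) w @ caps m"
  have closure: "braid_closure (Suc m) (v @ x # w) = cups m @ [cup] @ map (letter_slice (Suc m)) v @
      letter_slice (Suc m) x # map (letter_slice (Suc m)) w @ [cap] @ caps m"
    by (simp add: braid_closure_eq cups_Suc caps_Suc cup_def cap_def)
  have "link_diagram (braid_closure (Suc m) (v @ x # w))"
    using vw x by (intro link_diagram_braid_closure) (auto simp: m_def intro: braid_word_mono)
  then have step1: "link_diagram (?A @ [cup] @
        letter_slice (Suc m) x # map (letter_slice (Suc m)) w @ [cap] @ caps m)"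
    "V (braid_closure (Suc m) (v @ x # w)) = V (?A @ [cup] @
        letter_slice (Suc m) x # map (letter_slice (Suc m)) w @ [cap] @ caps m)"
    using cup[of "cups m" "letter_slice (Suc m) x # map (letter_slice (Suc m)) w @ [cap] @ caps m"]
    by (simp_all add: closure)
  have step2: "link_diagram (?A @ [cup, letter_slice (Suc m) x, cap] @ ?B)"
    "V (braid_closure (Suc m) (v @ x # w)) = V (?A @ [cup, letter_slice (Suc m) x, cap] @ ?B)"
    using cap[of "?A @ [cup, letter_slice (Suc m) x]" "caps m"] step1 by simp_all
  \<comment> \<open>Between the isolated minimum and maximum only a curl on the last strand is left,
    which is the left side of \<open>R1\<close>.\<close>
  have kink: "whisker (replicate n Up) (replicate m Down)
      [([Up], Cup Up, []), ([], letter_crossing x, [Down]), ([Up], Cap Up, [])]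
      = [cup, letter_slice (Suc m) x, cap]"
    by (simp add: whisker_def slice cup_def cap_def m_def replicate_append_same slice[unfolded m_def])
  have ups: "replicate m Up @ zs = replicate n Up @ Up # zs" for zs
    by (simp add: m_def replicate_app_Cons_same)
  have crossing: "letter_crossing x \<in> {PosX, NegX}"
    by (cases x) auto
  have "V (?A @ whisker (replicate n Up) (replicate m Down)
      [([Up], Cup Up, []), ([], letter_crossing x, [Down]), ([Up], Cap Up, [])] @ ?B) =
      V (?A @ whisker (replicate n Up) (replicate m Down) [] @ ?B)"
  proof (intro jones_local_move[OF V R1[OF crossing]])
    show "tangle_diagram u (whisker (replicate n Up) (replicate m Down) []) v"
      if "tangle_diagram u (whisker (replicate n Up) (replicate m Down)
        [([Up], Cup Up, []), ([], letter_crossing x, [Down]), ([Up], Cap Up, [])]) v" for u v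
      using that unfolding kink by (auto simp: cup_def cap_def slice whisker_def ups)
  qed (simp only: kink step2(1))
  then have "V (?A @ [cup, letter_slice (Suc m) x, cap] @ ?B) =
      V (?A @ whisker (replicate n Up) (replicate m Down) [] @ ?B)"
    by (simp only: kink)
  then show ?thesis
    using step2(2) by (simp add: braid_closure_eq whisker_def m_def)
qed

section \<open>Braid relations and skein relation on closures\<close>

lemma jones_braid_R3:
  assumes V: "jones_polynomial V" and "braid_word n (v @ [Sigma (Suc i), Sigma (Suc (Suc i)), Sigma (Suc i)] @ w)"
  shows "V (braid_closure n (v @ [Sigma (Suc i), Sigma (Suc (Suc i)), Sigma (Suc i)] @ w)) =
    V (braid_closure n (v @ [Sigma (Suc (Suc i)), Sigma (Suc i), Sigma (Suc (Suc i))] @ w))"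
proof -
  obtain j where j: "n = i + 3 + j"
    using assms(2) less_imp_Suc_add[of "Suc (Suc i)" n] by auto
  have s: "letter_slice n (Sigma (Suc i)) = (replicate i Up, PosX, Up # replicate j Up @ replicate n Down)"
    "letter_slice n (Sigma (Suc (Suc i))) = (replicate i Up @ [Up], PosX, replicate j Up @ replicate n Down)"
    by (simp_all add: letter_slice_def j replicate_append_same)
  show ?thesis
    using jones_local_move[OF V R3, of "cups n @ map (letter_slice n) v" "replicate i Up"
        "replicate j Up @ replicate n Down" "map (letter_slice n) w @ caps n"]
      link_diagram_braid_closure[OF assms(2)]
    by (simp add: braid_closure_eq whisker_def s)
qed

lemma jones_braid_far:
  assumes V: "jones_polynomial V" and "Suc i < j" and "braid_word n (v @ [Sigma (Suc i), Sigma (Suc j)] @ w)"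
  shows "V (braid_closure n (v @ [Sigma (Suc i), Sigma (Suc j)] @ w)) =
    V (braid_closure n (v @ [Sigma (Suc j), Sigma (Suc i)] @ w))"
proof -
  obtain p where p: "j = i + 2 + p"
    using less_imp_Suc_add[OF assms(2)] by auto
  obtain q where q: "n = j + 2 + q"
    using assms(3) less_imp_Suc_add[of "Suc j" n] by auto
  have s: "letter_slice n (Sigma (Suc i)) =
      (replicate i Up, PosX, replicate p Up @ [Up, Up] @ replicate q Up @ replicate n Down)"
    "letter_slice n (Sigma (Suc j)) =
      (replicate i Up @ [Up, Up] @ replicate p Up, PosX, replicate q Up @ replicate n Down)"
    by (simp_all add: letter_slice_def q p replicate_add numeral_2_eq_2 replicate_app_Cons_same)
  show ?thesis
    using jones_exchange[OF V, of "cups n @ map (letter_slice n) v" "replicate i Up" PosX "replicate p Up" PosX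
        "replicate q Up @ replicate n Down" "map (letter_slice n) w @ caps n"]
      link_diagram_braid_closure[OF assms(3)]
    by (simp add: braid_closure_eq s)
qed

lemma jones_braid_cancel:
  assumes V: "jones_polynomial V" and "braid_word n (v @ [Sigma i, SigmaInv i] @ w)"
  shows "V (braid_closure n (v @ [Sigma i, SigmaInv i] @ w)) = V (braid_closure n (v @ w))"
proof -
  let ?a = "replicate (i - 1) Up" and ?b = "replicate (n - 1 - i) Up @ replicate n Down"
  have "V ((cups n @ map (letter_slice n) v) @ whisker ?a ?b [([], PosX, []), ([], NegX, [])] @
        map (letter_slice n) w @ caps n)
    = V ((cups n @ map (letter_slice n) v) @ whisker ?a ?b [] @ map (letter_slice n) w @ caps n)"
    by (intro jones_local_move[OF V R2])
      (use link_diagram_braid_closure[OF assms(2)] in \<open>auto simp: braid_closure_eq whisker_def letter_slice_def\<close>)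
  then show ?thesis
    by (simp add: braid_closure_eq whisker_def letter_slice_def)
qed

lemma jones_braid_skein:
  assumes "jones_polynomial V" and "braid_word n (v @ [Sigma i] @ w)"
  shows "inverse t_var * V (braid_closure n (v @ [Sigma i] @ w))
      - t_var * V (braid_closure n (v @ [SigmaInv i] @ w))
    = (t_half - inverse t_half) * V (braid_closure n (v @ w))"
proof -
  let ?a = "replicate (i - 1) Up" and ?b = "replicate (n - 1 - i) Up @ replicate n Down"
  let ?A = "cups n @ map (letter_slice n) v" and ?B = "map (letter_slice n) w @ caps n"
  have "link_diagram (?A @ [(?a, PosX, ?b)] @ ?B)"
    using link_diagram_braid_closure[OF assms(2)] by (simp add: braid_closure_eq letter_slice_def)
  then have "inverse t_var * V (?A @ [(?a, PosX, ?b)] @ ?B) - t_var * V (?A @ [(?a, NegX, ?b)] @ ?B)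
      = (t_half - inverse t_half) * V (?A @ ?B)"
    using assms(1) unfolding jones_polynomial_def by blast
  then show ?thesis
    by (simp add: braid_closure_eq letter_slice_def)
qed

lemma jones_closure_one: "jones_polynomial V \<Longrightarrow> V (braid_closure 1 []) = 1"
  by (simp add: jones_polynomial_def braid_closure_def unknot_diagram_def)

section \<open>Functionals on positive braid words\<close>

text \<open>
  The letter \<open>i\<close> stands for the generator of index \<open>i + 1\<close>, so words over \<open>{..<n}\<close> are
  positive braid words on \<open>n + 1\<close> strands.
\<close>

definition hecke_functional :: "'a::comm_ring_1 \<Rightarrow> 'a \<Rightarrow> nat \<Rightarrow> (nat list \<Rightarrow> 'a) \<Rightarrow> bool" where
  "hecke_functional \<alpha> \<beta> n f \<longleftrightarrow> (\<forall>x\<in>lists {..<n}. \<forall>y\<in>lists {..<n}.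
     (\<forall>i<n. f (x @ [i, i] @ y) = \<alpha> * f (x @ [i] @ y) + \<beta> * f (x @ y)) \<and>
     (\<forall>i. Suc i < n \<longrightarrow> f (x @ [i, Suc i, i] @ y) = f (x @ [Suc i, i, Suc i] @ y)) \<and>
     (\<forall>i j. Suc i < j \<and> j < n \<longrightarrow> f (x @ [i, j] @ y) = f (x @ [j, i] @ y)))"

lemma
  assumes "hecke_functional \<alpha> \<beta> n f" "x \<in> lists {..<n}" "y \<in> lists {..<n}"
  shows hecke_functional_square:
      "i < n \<Longrightarrow> f (x @ i # i # y) = \<alpha> * f (x @ i # y) + \<beta> * f (x @ y)"
    and hecke_functional_braid:
      "Suc i < n \<Longrightarrow> f (x @ i # Suc i # i # y) = f (x @ Suc i # i # Suc i # y)"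
    and hecke_functional_far:
      "Suc i < j \<Longrightarrow> j < n \<Longrightarrow> f (x @ i # j # y) = f (x @ j # i # y)"
  using bspec[OF bspec[OF assms(1)[unfolded hecke_functional_def] assms(2)] assms(3)] by auto

lemma lists_lessThan_Suc: "x \<in> lists {..<n} \<Longrightarrow> x \<in> lists {..<Suc n}"
  by (auto simp: in_lists_conv_set)

text \<open>Fixing the outer parts of a word lets an induction hypothesis for fewer letters act on
  its interior.\<close>

lemma hecke_functional_context:
  assumes "hecke_functional \<alpha> \<beta> n f" "x \<in> lists {..<n}" "y \<in> lists {..<n}" "m \<le> n"
  shows "hecke_functional \<alpha> \<beta> m (\<lambda>w. f (x @ w @ y))"
  unfolding hecke_functional_def
proof (intro ballI)
  fix u v assume "u \<in> lists {..<m}" "v \<in> lists {..<m}"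
  then have xu: "x @ u \<in> lists {..<n}" and vy: "v @ y \<in> lists {..<n}"
    using assms(2-4) by (fastforce simp: in_lists_conv_set)+
  show "(\<forall>i<m. f (x @ (u @ [i, i] @ v) @ y) = \<alpha> * f (x @ (u @ [i] @ v) @ y) + \<beta> * f (x @ (u @ v) @ y)) \<and>
    (\<forall>i. Suc i < m \<longrightarrow> f (x @ (u @ [i, Suc i, i] @ v) @ y) = f (x @ (u @ [Suc i, i, Suc i] @ v) @ y)) \<and>
    (\<forall>i j. Suc i < j \<and> j < m \<longrightarrow> f (x @ (u @ [i, j] @ v) @ y) = f (x @ (u @ [j, i] @ v) @ y))"
  proof (intro conjI allI impI, goal_cases)
    case (1 i)
    then show ?case using hecke_functional_square[OF assms(1) xu vy, of i] assms(4) by simp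
  next
    case (2 i)
    then show ?case using hecke_functional_braid[OF assms(1) xu vy, of i] assms(4) by simp
  next
    case (3 i j)
    then show ?case using hecke_functional_far[OF assms(1) xu vy, of i j] assms(4) by simp
  qed
qed

lemma hecke_functional_far_word:
  assumes "hecke_functional \<alpha> \<beta> (Suc (Suc n)) f" "x \<in> lists {..<Suc (Suc n)}" "y \<in> lists {..<Suc (Suc n)}"
    and "v \<in> lists {..<n}"
  shows "f (x @ v @ Suc n # y) = f (x @ Suc n # v @ y)"
  using assms(4,2)
proof (induction v arbitrary: x rule: list.induct)
  case (Cons i v)
  have i: "i < n" and v: "v \<in> lists {..<n}" and x: "x \<in> lists {..<Suc (Suc n)}"
    using Cons.prems by auto
  have vy: "v @ y \<in> lists {..<Suc (Suc n)}"
    using v assms(3) by (auto simp: in_lists_conv_set)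
  have "f (x @ i # v @ Suc n # y) = f (x @ i # Suc n # v @ y)"
    using Cons.IH[OF v, of "x @ [i]"] x i by simp
  also have "\<dots> = f (x @ Suc n # i # v @ y)"
    using hecke_functional_far[OF assms(1) x vy, of i "Suc n"] i by simp
  finally show ?case by simp
qed simp

section \<open>Reduction to at most one top letter, and uniqueness of Markov functionals\<close>

lemma first_two_occurrences:
  assumes "w \<in> lists {..<Suc n}"
  obtains "w \<in> lists {..<n}"
  | u v where "w = u @ n # v" "u \<in> lists {..<n}" "v \<in> lists {..<n}"
  | u v z where "w = u @ n # v @ n # z" "u \<in> lists {..<n}" "v \<in> lists {..<n}" "z \<in> lists {..<Suc n}"
proof -
  have split: "x \<in> lists {..<n} \<or> (\<exists>u\<in>lists {..<n}. \<exists>z\<in>lists {..<Suc n}. x = u @ n # z)"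
    if x: "x \<in> lists {..<Suc n}" for x
  proof (cases "n \<in> set x")
    case True
    then obtain u z where uz: "x = u @ n # z" "n \<notin> set u"
      using split_list_first[of n x] by blast
    then have "u \<in> lists {..<n}" "z \<in> lists {..<Suc n}"
      using x by (auto simp: in_lists_conv_set less_Suc_eq)
    then show ?thesis using uz(1) by blast
  next
    case False
    then have "x \<in> lists {..<n}"
      using x by (auto simp: in_lists_conv_set less_Suc_eq)
    then show ?thesis by simp
  qed
  show thesis
  proof (cases "w \<in> lists {..<n}")
    case False
    then obtain u z where u: "u \<in> lists {..<n}" and z: "z \<in> lists {..<Suc n}" and w: "w = u @ n # z"
      using split[OF assms] by metis
    show thesis
    proof (cases "z \<in> lists {..<n}")
      case False
      then obtain v z' where "v \<in> lists {..<n}" "z' \<in> lists {..<Suc n}" "z = v @ n # z'"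
        using split[OF z] by metis
      then show thesis using that(3)[of u v z'] u w by simp
    qed (use that(2)[of u z] u w in simp)
  qed (rule that(1))
qed

text \<open>
  This is the decomposition \<open>H\<^sub>n\<^sub>+\<^sub>1 = H\<^sub>n + H\<^sub>n g\<^sub>n H\<^sub>n\<close> of Hecke algebras, stated for functionals.
\<close>

lemma hecke_functional_eq_zero:
  assumes "hecke_functional \<alpha> \<beta> (Suc n) f"
    and "\<And>x. x \<in> lists {..<n} \<Longrightarrow> f x = 0"
    and "\<And>x y. x \<in> lists {..<n} \<Longrightarrow> y \<in> lists {..<n} \<Longrightarrow> f (x @ n # y) = 0"
    and "w \<in> lists {..<Suc n}"
  shows "f w = 0"
  using assms
proof (induction n arbitrary: f w)
  case 0
  show ?case
    using 0(4)
  proof (induction "length w" arbitrary: w rule: less_induct)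
    case less
    show ?case
      using less.prems
    proof (cases rule: first_two_occurrences)
      case (3 u v z)
      then have w: "w = [] @ 0 # 0 # z"
        by simp
      have "f w = \<alpha> * f ([] @ 0 # z) + \<beta> * f ([] @ z)"
        unfolding w using 3 by (intro hecke_functional_square[OF 0(1)]) auto
      then show ?thesis using less.hyps 3 by simp
    qed (use 0(2,3) in auto)
  qed
next
  case (Suc n)
  let ?W = "lists {..<Suc (Suc n)}"
  show ?case
    using Suc.prems(4)
  \<comment> \<open>The measure is the number of top letters; words with at most one are covered by
    the hypotheses.\<close>
  proof (induction "count_list w (Suc n)" arbitrary: w rule: less_induct)
    case less
    show ?case
      using less.prems
    proof (cases rule: first_two_occurrences)
      case (3 u v z)
      have uz: "u @ [Suc n] \<in> ?W" "Suc n # z \<in> ?W"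
        using 3 lists_lessThan_Suc by auto
      have u: "u @ x \<in> ?W" if "x \<in> lists {..<n}" for x
        using 3 that by (fastforce simp: in_lists_conv_set)
      have z: "x @ z \<in> ?W" if "x \<in> lists {..<n}" for x
        using 3 that by (fastforce simp: in_lists_conv_set)
      have count: "count_list x (Suc n) = 0" if "x \<in> lists {..<n}" for x
        using that by (auto simp: count_list_0_iff)
      \<comment> \<open>The stretch between the first two top letters uses the smaller alphabet, so
        by the outer induction hypothesis it may be assumed to contain \<open>n\<close> at most
        once.\<close>
      let ?g = "\<lambda>v. f ((u @ [Suc n]) @ v @ (Suc n # z))"
      have "?g v = 0"
      proof (rule Suc.IH[of ?g])
        show "hecke_functional \<alpha> \<beta> (Suc n) ?g"
          by (rule hecke_functional_context[OF Suc.prems(1) uz]) simp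
        show "v \<in> lists {..<Suc n}" by fact
        show "?g x = 0" if x: "x \<in> lists {..<n}" for x
        proof -
          \<comment> \<open>Without \<open>n\<close>, the stretch commutes with the top letter; the
            two top letters become adjacent and the quadratic relation lowers their number.\<close>
          have "?g x = f ((u @ x) @ Suc n # Suc n # z)"
            using hecke_functional_far_word[OF Suc.prems(1) _ uz(2) x, of u] 3 lists_lessThan_Suc by simp
          also have "\<dots> = \<alpha> * f ((u @ x) @ Suc n # z) + \<beta> * f ((u @ x) @ z)"
            using 3 x u by (intro hecke_functional_square[OF Suc.prems(1)]) auto
          also have "f ((u @ x) @ Suc n # z) = 0"
            using 3 u[OF x] uz x by (intro less.hyps) (auto simp: count[OF x])
          also have "f ((u @ x) @ z) = 0"
            using 3 u[OF x] by (intro less.hyps) (auto simp: count[OF x])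
          finally show ?thesis by simp
        qed
        show "?g (x @ n # y) = 0" if xy: "x \<in> lists {..<n}" "y \<in> lists {..<n}" for x y
        proof -
          \<comment> \<open>Here \<open>x\<close> and \<open>y\<close> move outwards, and the braid
            relation turns \<open>Suc n, n, Suc n\<close> into \<open>n, Suc n, n\<close>, with one
            top letter fewer.\<close>
          have "?g (x @ n # y) = f (u @ Suc n # x @ n # y @ Suc n # z)"
            by simp
          also have "\<dots> = f ((u @ x) @ Suc n # n # y @ Suc n # z)"
            using hecke_functional_far_word[OF Suc.prems(1) _ _ xy(1), of u "n # y @ Suc n # z"] 3 uz z[OF xy(2)]
              lists_lessThan_Suc[of _ "Suc n"] lists_lessThan_Suc[OF lists_lessThan_Suc, OF xy(2)] by simp
          also have "\<dots> = f ((u @ x @ [Suc n, n]) @ y @ Suc n # z)"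
            by simp
          also have "\<dots> = f ((u @ x @ [Suc n, n]) @ Suc n # y @ z)"
            using 3 u[OF xy(1)] by (intro hecke_functional_far_word[OF Suc.prems(1) _ _ xy(2)]) auto
          also have "\<dots> = f ((u @ x) @ n # Suc n # n # y @ z)"
            using hecke_functional_braid[OF Suc.prems(1) u[OF xy(1)] z[OF xy(2)], of n] by simp
          also have "\<dots> = 0"
            using 3 u[OF xy(1)] z[OF xy(2)] xy by (intro less.hyps) (auto simp: count[OF xy(1)] count[OF xy(2)])
          finally show ?thesis .
        qed
      qed
      then show ?thesis using 3(1) by simp
    qed (use Suc.prems(2,3) in auto)
  qed
qed

lemma hecke_functional_linear:
  assumes "hecke_functional \<alpha> \<beta> n f" "hecke_functional \<alpha> \<beta> n g"
  shows "hecke_functional \<alpha> \<beta> n (\<lambda>w. c * f w + d * g w)"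
  unfolding hecke_functional_def
proof (intro ballI)
  fix x y assume xy: "x \<in> lists {..<n}" "y \<in> lists {..<n}"
  let ?d = "\<lambda>w. c * f w + d * g w"
  show "(\<forall>i<n. ?d (x @ [i, i] @ y) = \<alpha> * ?d (x @ [i] @ y) + \<beta> * ?d (x @ y)) \<and>
    (\<forall>i. Suc i < n \<longrightarrow> ?d (x @ [i, Suc i, i] @ y) = ?d (x @ [Suc i, i, Suc i] @ y)) \<and>
    (\<forall>i j. Suc i < j \<and> j < n \<longrightarrow> ?d (x @ [i, j] @ y) = ?d (x @ [j, i] @ y))"
  proof (intro conjI allI impI, goal_cases)
    case (1 i)
    then show ?case
      using hecke_functional_square[OF assms(1) xy, of i] hecke_functional_square[OF assms(2) xy, of i]
      by (simp add: algebra_simps)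
  next
    case (2 i)
    then show ?case
      using hecke_functional_braid[OF assms(1) xy, of i] hecke_functional_braid[OF assms(2) xy, of i] by simp
  next
    case (3 i j)
    then show ?case
      using hecke_functional_far[OF assms(1) xy, of i j] hecke_functional_far[OF assms(2) xy, of i j] by simp
  qed
qed

text \<open>On words with at most one top letter both families reduce to the previous level, so
  their difference satisfies the hypotheses of \<open>hecke_functional_eq_zero\<close>.\<close>

lemma markov_functional_unique:
  fixes f g :: "nat \<Rightarrow> nat list \<Rightarrow> 'a::comm_ring_1"
  assumes "\<And>n. hecke_functional \<alpha> \<beta> n (f n)" "\<And>n. hecke_functional \<alpha> \<beta> n (g n)"
    and "\<And>n x. x \<in> lists {..<n} \<Longrightarrow> f (Suc n) x = \<mu> * f n x"
    and "\<And>n x. x \<in> lists {..<n} \<Longrightarrow> g (Suc n) x = \<mu> * g n x"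
    and "\<And>n x y. x \<in> lists {..<n} \<Longrightarrow> y \<in> lists {..<n} \<Longrightarrow> f (Suc n) (x @ n # y) = f n (x @ y)"
    and "\<And>n x y. x \<in> lists {..<n} \<Longrightarrow> y \<in> lists {..<n} \<Longrightarrow> g (Suc n) (x @ n # y) = g n (x @ y)"
    and "f 0 [] = g 0 []" and "w \<in> lists {..<n}"
  shows "f n w = g n w"
  using assms(8)
proof (induction n arbitrary: w)
  case (Suc n)
  have "f (Suc n) w - g (Suc n) w = 0"
  proof (rule hecke_functional_eq_zero[where f = "\<lambda>w. f (Suc n) w - g (Suc n) w", OF _ _ _ Suc.prems])
    show "hecke_functional \<alpha> \<beta> (Suc n) (\<lambda>w. f (Suc n) w - g (Suc n) w)"
      using hecke_functional_linear[OF assms(1,2), of "Suc n" 1 "- 1"] by simp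
  qed (use assms(3-6) Suc.IH in auto)
  then show ?case by simp
qed (use assms(7) in auto)

section \<open>A matrix model\<close>

text \<open>
  Functions on \<open>bool list\<close> stand for vectors in tensor powers of a free module of rank two.
  The operator \<open>gop a b i\<close> is the Jones R-matrix, with eigenvalues \<open>1\<close> and \<open>- a * b\<close>, at the
  positions \<open>i\<close> and \<open>i + 1\<close>. Only \<open>a * b = t\<close> matters for traces: the choice \<open>a = 1\<close>, \<open>b = t\<close>
  has entries in \<open>\<int>[t]\<close>, and \<open>a = b = t\<^sup>1\<^sup>/\<^sup>2\<close> is compatible with cups.
\<close>

fun gop :: "'a::comm_ring_1 \<Rightarrow> 'a \<Rightarrow> nat \<Rightarrow> (bool list \<Rightarrow> 'a) \<Rightarrow> bool list \<Rightarrow> 'a" where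
  "gop a b 0 f (x # y # zs) =
     (if x = y then f (x # y # zs)
      else if y then - a * f (True # False # zs)
      else (1 - a * b) * f (True # False # zs) - b * f (False # True # zs))"
| "gop a b (Suc i) f (x # xs) = gop a b i (\<lambda>ys. f (x # ys)) xs"
| "gop a b i f xs = f xs"

abbreviation gops :: "'a::comm_ring_1 \<Rightarrow> 'a \<Rightarrow> nat list \<Rightarrow> (bool list \<Rightarrow> 'a) \<Rightarrow> bool list \<Rightarrow> 'a" where
  "gops a b \<equiv> foldr (gop a b)"

lemma gop_cong:
  assumes "\<And>ys. length ys = length xs \<Longrightarrow> f ys = g ys"
  shows "gop a b i f xs = gop a b i g xs"
  using assms by (induction a b i f xs arbitrary: g rule: gop.induct) auto

lemma gops_cong:
  assumes "\<And>ys. length ys = length xs \<Longrightarrow> f ys = g ys"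
  shows "gops a b w f xs = gops a b w g xs"
  using assms by (induction w arbitrary: xs) (auto intro!: gop_cong)

lemma gop_linear:
  "gop a b i (\<lambda>xs. c * f xs + d * g xs) xs = c * gop a b i f xs + d * gop a b i g xs"
proof (induction i arbitrary: f g xs)
  case 0
  then show ?case
    by (cases "(a, b, 0::nat, f, xs)" rule: gop.cases) (auto simp: algebra_simps)
next
  case (Suc i)
  then show ?case by (cases xs) auto
qed

lemma gops_linear:
  "gops a b w (\<lambda>xs. c * f xs + d * g xs) xs = c * gops a b w f xs + d * gops a b w g xs"
proof (induction w arbitrary: xs)
  case (Cons i w)
  have "gops a b (i # w) (\<lambda>xs. c * f xs + d * g xs) xs =
      gop a b i (\<lambda>xs. c * gops a b w f xs + d * gops a b w g xs) xs"
    by (simp, intro gop_cong Cons.IH)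
  then show ?case by (simp add: gop_linear)
qed simp

lemma gops_zero: "gops a b w (\<lambda>_. 0) xs = 0"
  using gops_linear[of a b w 0 "\<lambda>_. 0" 0 "\<lambda>_. 0" xs] by simp

lemma gops_scale: "gops a b w (\<lambda>xs. c * f xs) xs = c * gops a b w f xs"
  using gops_linear[of a b w c f 0 f xs] by simp

lemma gop_square:
  "gop a b i (gop a b i f) xs = (1 - a * b) * gop a b i f xs + a * b * f xs"
proof (induction i arbitrary: f xs)
  case 0
  then show ?case
    by (cases "(a, b, 0::nat, f, xs)" rule: gop.cases) (auto simp: algebra_simps)
next
  case (Suc i)
  then show ?case by (cases xs) (auto simp: algebra_simps)
qed

text \<open>The Yang-Baxter equation. A prefix is inert, so it is a check over the states of three
  positions.\<close>

lemma gop_braid: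
  "Suc (Suc i) < length xs \<Longrightarrow>
    gop a b i (gop a b (Suc i) (gop a b i f)) xs = gop a b (Suc i) (gop a b i (gop a b (Suc i) f)) xs"
proof (induction i arbitrary: f xs)
  case 0
  then obtain x y z zs where "xs = x # y # z # zs"
    by (cases xs; cases "tl xs"; cases "tl (tl xs)") auto
  then show ?case by (auto simp: algebra_simps)
next
  case (Suc i)
  then show ?case by (cases xs) auto
qed

lemma gop_far: "Suc i < j \<Longrightarrow> gop a b i (gop a b j f) xs = gop a b j (gop a b i f) xs"
proof (induction i arbitrary: f xs j)
  case 0
  then obtain k where j: "j = Suc (Suc k)"
    by (cases j; cases "j - 1") auto
  have "gop a b k (\<lambda>zs. c * f zs - d * g zs) zs = c * gop a b k f zs - d * gop a b k g zs"
    for c d f g zs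
    using gop_linear[of a b k c f "- d" g zs] by simp
  moreover have "gop a b k (\<lambda>zs. - (c * f zs)) zs = - (c * gop a b k f zs)" for c f zs
    using gop_linear[of a b k "- c" f 0 f zs] by simp
  ultimately show ?case
    unfolding j by (cases "(a, b, 0::nat, f, xs)" rule: gop.cases) auto
next
  case (Suc i)
  then obtain k where j: "j = Suc k"
    by (cases j) auto
  show ?case using Suc.IH[of k] Suc.prems unfolding j by (cases xs) auto
qed

lemma gop_append:
  "Suc i < length xs \<Longrightarrow> gop a b i f (xs @ zs) = gop a b i (\<lambda>ys. f (ys @ zs)) xs"
proof (induction i arbitrary: f xs)
  case 0
  then obtain x y ys where "xs = x # y # ys"
    by (cases xs; cases "tl xs") auto
  then show ?case by auto
next
  case (Suc i)
  then show ?case by (cases xs) auto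
qed

lemma gop_append_right: "gop a b (length xs) f (xs @ ys) = gop a b 0 (\<lambda>zs. f (xs @ zs)) ys"
  by (induction xs arbitrary: f) auto

lemma gops_append:
  "w \<in> lists {..<n} \<Longrightarrow> length xs = Suc n \<Longrightarrow>
    gops a b w f (xs @ zs) = gops a b w (\<lambda>ys. f (ys @ zs)) xs"
proof (induction w arbitrary: xs rule: list.induct)
  case (Cons i w)
  then have "gops a b (i # w) f (xs @ zs) = gop a b i (\<lambda>ys. gops a b w f (ys @ zs)) xs"
    by (auto simp: gop_append)
  also have "\<dots> = gop a b i (gops a b w (\<lambda>ys. f (ys @ zs))) xs"
    using Cons by (intro gop_cong) auto
  finally show ?case by simp
qed simp

section \<open>Weighted traces and their Markov property\<close>

primrec lsum :: "nat \<Rightarrow> (bool list \<Rightarrow> 'a::comm_ring_1) \<Rightarrow> 'a" where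
  "lsum 0 f = f []"
| "lsum (Suc n) f = lsum n (\<lambda>xs. f (False # xs)) + lsum n (\<lambda>xs. f (True # xs))"

lemma lsum_cong:
  "(\<And>xs. length xs = n \<Longrightarrow> f xs = g xs) \<Longrightarrow> lsum n f = lsum n g"
proof (induction n arbitrary: f g)
  case (Suc n)
  show ?case
    using Suc.IH[of "\<lambda>xs. f (False # xs)" "\<lambda>xs. g (False # xs)"]
      Suc.IH[of "\<lambda>xs. f (True # xs)" "\<lambda>xs. g (True # xs)"] Suc.prems by simp
qed simp

lemma lsum_add: "lsum n (\<lambda>xs. f xs + g xs) = lsum n f + lsum n g"
  by (induction n arbitrary: f g) (simp_all add: algebra_simps)

lemma lsum_scale: "lsum n (\<lambda>xs. c * f xs) = c * lsum n f"
  by (induction n arbitrary: f) (simp_all add: algebra_simps)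

text \<open>The recursion of \<open>lsum\<close> exposes the first position, whereas strands are
  added and removed at the last one.\<close>

lemma lsum_snoc: "lsum (Suc n) f = lsum n (\<lambda>xs. f (xs @ [False]) + f (xs @ [True]))"
proof (induction n arbitrary: f)
  case (Suc n)
  show ?case
    using Suc.IH[of "\<lambda>xs. f (False # xs)"] Suc.IH[of "\<lambda>xs. f (True # xs)"] by simp
qed simp

definition delta :: "bool list \<Rightarrow> bool list \<Rightarrow> 'a::comm_ring_1" where
  "delta xs ys = (if ys = xs then 1 else 0)"

abbreviation minuses :: "bool list \<Rightarrow> nat" where
  "minuses xs \<equiv> count_list xs True"

text \<open>
  Leaving the first strand open, with state \<open>x\<close>, makes the trace of the identity on one strand
  a power of \<open>t\<close>.
\<close>

definition ptrace :: "'a::comm_ring_1 \<Rightarrow> bool \<Rightarrow> nat \<Rightarrow> ((bool list \<Rightarrow> 'a) \<Rightarrow> bool list \<Rightarrow> 'a) \<Rightarrow> 'a" where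
  "ptrace t x n F = lsum n (\<lambda>xs. t ^ minuses (x # xs) * F (delta (x # xs)) (x # xs))"

lemma delta_append: "delta (xs @ [z]) (ys @ [y]) = (if y = z then delta xs ys else 0)"
  by (simp add: delta_def)

lemma gops_delta_append:
  assumes "w \<in> lists {..<n}" "length ys = Suc n"
  shows "gops a b w (delta (xs @ [z])) (ys @ [y]) = (if y = z then gops a b w (delta xs) ys else 0)"
  using gops_append[OF assms, of a b "delta (xs @ [z])" "[y]"] by (simp add: delta_append gops_zero)

text \<open>The last strand is untouched by \<open>w\<close>, and its two states have the weights
  \<open>1\<close> and \<open>t\<close>.\<close>

lemma ptrace_Suc:
  assumes "w \<in> lists {..<n}"
  shows "ptrace t x (Suc n) (gops a b w) = (1 + t) * ptrace t x n (gops a b w)"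
proof -
  have "t ^ minuses (x # xs @ [False]) * gops a b w (delta (x # xs @ [False])) (x # xs @ [False]) +
      t ^ minuses (x # xs @ [True]) * gops a b w (delta (x # xs @ [True])) (x # xs @ [True])
    = (1 + t) * (t ^ minuses (x # xs) * gops a b w (delta (x # xs)) (x # xs))"
    if "length xs = n" for xs
    using gops_delta_append[OF assms, of "x # xs" a b "x # xs"] that by (simp add: algebra_simps)
  then show ?thesis
    unfolding ptrace_def lsum_snoc lsum_scale[symmetric] by (intro lsum_cong) auto
qed

text \<open>Summing out the last strand with weights \<open>1\<close> and \<open>a * b\<close> turns
  the R-matrix into the identity: next to \<open>True\<close> the diagonal entries give
  \<open>(1 - a * b) + a * b\<close>, next to \<open>False\<close> they give
  \<open>1 + 0\<close>.\<close>

lemma ptrace_markov: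
  assumes v: "v \<in> lists {..<n}" and w: "w \<in> lists {..<n}"
  shows "ptrace (a * b) x (Suc n) (gops a b (v @ n # w)) = ptrace (a * b) x n (gops a b (v @ w))"
proof -
  have "gops a b (v @ n # w) (delta (xs @ [False])) (xs @ [False]) +
      a * b * gops a b (v @ n # w) (delta (xs @ [True])) (xs @ [True])
    = gops a b (v @ w) (delta xs) xs"
    if len: "length xs = Suc n" for xs
  proof -
    define h where "h z = gop a b n (gops a b w (delta (xs @ [z])))" for z
    have h: "h False (ys @ [False]) + a * b * h True (ys @ [True]) = gops a b w (delta xs) ys"
      if "length ys = length xs" for ys
    proof -
      obtain us u where ys: "ys = us @ [u]" "length us = n"
        using \<open>length ys = length xs\<close> len by (cases ys rule: rev_cases) auto
      have gop: "gop a b n f (us @ [u, z]) = gop a b 0 (\<lambda>zs. f (us @ zs)) [u, z]" for f u z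
        using gop_append_right[of a b us f "[u, z]"] ys(2) by simp
      have "gops a b w (delta (xs @ [z])) (us @ [u', y]) =
          (if y = z then gops a b w (delta xs) (us @ [u']) else 0)" for u' y z
        using gops_delta_append[OF w, of "us @ [u']" a b xs z y] ys(2) by simp
      then show ?thesis
        unfolding h_def ys by (cases u) (simp_all add: gop algebra_simps)
    qed
    have "gops a b (v @ n # w) (delta (xs @ [z])) (xs @ [z]) = gops a b v (\<lambda>ys. h z (ys @ [z])) xs" for z
      using gops_append[OF v len, of a b "h z" "[z]"] by (simp add: h_def)
    then have "gops a b (v @ n # w) (delta (xs @ [False])) (xs @ [False]) +
      a * b * gops a b (v @ n # w) (delta (xs @ [True])) (xs @ [True])
      = gops a b v (\<lambda>ys. h False (ys @ [False]) + a * b * h True (ys @ [True])) xs"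
      using gops_linear[of a b v 1 "\<lambda>ys. h False (ys @ [False])" "a * b" "\<lambda>ys. h True (ys @ [True])" xs] by simp
    also have "\<dots> = gops a b v (gops a b w (delta xs)) xs"
      by (rule gops_cong) (rule h)
    finally show ?thesis by simp
  qed
  note trace = this
  have "(a * b) ^ minuses (x # xs @ [False]) * gops a b (v @ n # w) (delta (x # xs @ [False])) (x # xs @ [False]) +
      (a * b) ^ minuses (x # xs @ [True]) * gops a b (v @ n # w) (delta (x # xs @ [True])) (x # xs @ [True])
    = (a * b) ^ minuses (x # xs) * gops a b (v @ w) (delta (x # xs)) (x # xs)"
    if "length xs = n" for xs
  proof -
    have "minuses (x # xs @ [False]) = minuses (x # xs)" "minuses (x # xs @ [True]) = Suc (minuses (x # xs))"
      by simp_all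
    then show ?thesis
      using trace[of "x # xs"] that
      by (simp only: append_Cons list.size power_Suc2 distrib_left[symmetric] mult.assoc)
  qed
  then show ?thesis
    unfolding ptrace_def lsum_snoc by (intro lsum_cong) auto
qed

lemma hecke_functional_ptrace:
  "hecke_functional (1 - a * b) (a * b) n (\<lambda>w. ptrace t x n (gops a b w))"
  unfolding hecke_functional_def
proof (intro ballI)
  fix u v assume uv: "u \<in> lists {..<n}" "v \<in> lists {..<n}"
  let ?f = "\<lambda>w. ptrace t x n (gops a b w)"
  show "(\<forall>i<n. ?f (u @ [i, i] @ v) = (1 - a * b) * ?f (u @ [i] @ v) + a * b * ?f (u @ v)) \<and>
    (\<forall>i. Suc i < n \<longrightarrow> ?f (u @ [i, Suc i, i] @ v) = ?f (u @ [Suc i, i, Suc i] @ v)) \<and>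
    (\<forall>i j. Suc i < j \<and> j < n \<longrightarrow> ?f (u @ [i, j] @ v) = ?f (u @ [j, i] @ v))"
  proof (intro conjI allI impI, goal_cases)
    case (1 i)
    have eq: "gops a b (u @ [i, i] @ v) f xs = (1 - a * b) * gops a b (u @ [i] @ v) f xs + a * b * gops a b (u @ v) f xs" for f xs
      using gops_linear[of a b u "1 - a * b" "gop a b i (gops a b v f)" "a * b" "gops a b v f" xs]
      by (simp add: gop_square[abs_def])
    then show ?case
      unfolding ptrace_def lsum_scale[symmetric] lsum_add[symmetric]
      by (intro lsum_cong, subst eq, simp only: algebra_simps)
  next
    case (2 i)
    then show ?case
      unfolding ptrace_def foldr_append foldr.simps o_apply id_apply
      by (intro lsum_cong arg_cong2[where f = "(*)"] gops_cong gop_braid refl) simp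
  next
    case (3 i j)
    then show ?case
      unfolding ptrace_def foldr_append foldr.simps o_apply id_apply
      by (intro lsum_cong arg_cong2[where f = "(*)"] gops_cong gop_far refl) simp
  qed
qed

lemma ptrace_Nil: "ptrace t x 0 (gops a b []) = t ^ of_bool x"
  by (simp add: ptrace_def delta_def)

section \<open>The Jones polynomial as a trace\<close>

lemma t_half_nonzero [simp]: "t_half \<noteq> 0"
  by (simp add: t_half_def)

lemma t_var_eq: "t_var = t_half * t_half"
  by (simp add: t_var_def power2_eq_square)

lemma t_var_power_eq_one_iff: "t_var ^ k = 1 \<longleftrightarrow> k = 0"
proof
  assume "t_var ^ k = 1"
  then have "fls_subdegree ((fls_X :: rat fls) ^ (2 * k)) = fls_subdegree (1 :: rat fls)"
    by (simp add: t_var_def t_half_def power_mult)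
  then show "k = 0" by simp
qed simp

abbreviation positive_word :: "nat list \<Rightarrow> braid_letter list" where
  "positive_word \<equiv> map (\<lambda>i. Sigma (Suc i))"

lemma braid_word_positive: "w \<in> lists {..<n} \<Longrightarrow> braid_word (Suc n) (positive_word w)"
  by (auto simp: braid_word_def)

lemma jones_braid_skein_positive:
  assumes "jones_polynomial V" and "braid_word n (v @ [Sigma i] @ w)"
  shows "V (braid_closure n (v @ [Sigma i] @ w)) =
    t_half * (t_var - 1) * V (braid_closure n (v @ w)) + t_var\<^sup>2 * V (braid_closure n (v @ [SigmaInv i] @ w))"
proof -
  have solve: "P = t * (z * X) + t\<^sup>2 * M" if "inverse t * P - t * M = z * X" "t \<noteq> 0" for t P M z X :: "rat fls"
    using that by (simp add: field_simps power2_eq_square)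
  have "t_var * (t_half - inverse t_half) = t_half * (t_var - 1)"
    by (simp add: t_var_eq field_simps)
  moreover have "t_var \<noteq> 0"
    by (simp add: t_var_def)
  ultimately show ?thesis
    using solve[OF jones_braid_skein[OF assms]] by (metis mult.assoc)
qed

text \<open>The skein relation at the second crossing, whose negative version cancels against the
  first.\<close>

lemma jones_braid_square:
  assumes V: "jones_polynomial V" and w: "braid_word n (v @ [Sigma i, Sigma i] @ w)"
  shows "V (braid_closure n (v @ [Sigma i, Sigma i] @ w)) =
    t_half * (t_var - 1) * V (braid_closure n (v @ [Sigma i] @ w)) + t_var\<^sup>2 * V (braid_closure n (v @ w))"
  using jones_braid_skein_positive[OF V, of n "v @ [Sigma i]" i w] jones_braid_cancel[OF V, of n v i w] w
  by simp

text \<open>In the skein relation for a crossing with the added strand, both signs stabilize to the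
  closure of \<open>w\<close> on the old strands, and the smoothing has the extra circle. A factor
  \<open>1 - t_var\<close> is then cancelled.\<close>

lemma jones_add_strand:
  assumes V: "jones_polynomial V" and w: "braid_word (Suc n) w"
  shows "- t_half * V (braid_closure (Suc (Suc n)) w) = (1 + t_var) * V (braid_closure (Suc n) w)"
proof -
  have "V (braid_closure (Suc n) w) = t_half * (t_var - 1) * V (braid_closure (Suc (Suc n)) w) +
      t_var\<^sup>2 * V (braid_closure (Suc n) w)"
    using jones_braid_skein_positive[OF V, of "Suc (Suc n)" w "Suc n" "[]"] w
      jones_stabilization[OF V _ w, of "Sigma (Suc n)" "[]"]
      jones_stabilization[OF V _ w, of "SigmaInv (Suc n)" "[]"] braid_word_mono[OF w]
    by simp
  then have "(1 - t_var) * ((1 + t_var) * V (braid_closure (Suc n) w)) =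
      (1 - t_var) * (- t_half * V (braid_closure (Suc (Suc n)) w))"
    by (simp add: algebra_simps power2_eq_square)
  moreover have "1 - t_var \<noteq> 0"
    using t_var_power_eq_one_iff[of 1] by simp
  ultimately show ?thesis
    by (metis mult_left_cancel)
qed

text \<open>The powers of \<open>- t_half\<close> turn the skein relation into
  \<open>g^2 = (1 - t) g + t\<close>; they cancel under stabilization, which adds one strand and one
  letter.\<close>

definition jones_trace :: "(slice list \<Rightarrow> rat fls) \<Rightarrow> nat \<Rightarrow> nat list \<Rightarrow> rat fls" where
  "jones_trace V n w = (- t_half) ^ n * inverse (- t_half) ^ length w * V (braid_closure (Suc n) (positive_word w))"

lemma hecke_functional_jones_trace:
  assumes V: "jones_polynomial V"
  shows "hecke_functional (1 - t_var) t_var n (jones_trace V n)"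
  unfolding hecke_functional_def
proof (intro ballI)
  fix x y assume xy: "x \<in> lists {..<n}" "y \<in> lists {..<n}"
  let ?f = "jones_trace V n"
  have word: "braid_word (Suc n) (positive_word (x @ z @ y))" if "z \<in> lists {..<n}" for z
    using xy that by (intro braid_word_positive) simp
  show "(\<forall>i<n. ?f (x @ [i, i] @ y) = (1 - t_var) * ?f (x @ [i] @ y) + t_var * ?f (x @ y)) \<and>
    (\<forall>i. Suc i < n \<longrightarrow> ?f (x @ [i, Suc i, i] @ y) = ?f (x @ [Suc i, i, Suc i] @ y)) \<and>
    (\<forall>i j. Suc i < j \<and> j < n \<longrightarrow> ?f (x @ [i, j] @ y) = ?f (x @ [j, i] @ y))"
  proof (intro conjI allI impI, goal_cases)
    case (1 i)
    have V2: "V (braid_closure (Suc n) (positive_word (x @ [i, i] @ y))) =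
        t_half * (t_var - 1) * V (braid_closure (Suc n) (positive_word (x @ [i] @ y))) +
        t_var\<^sup>2 * V (braid_closure (Suc n) (positive_word (x @ y)))"
      using jones_braid_square[OF V, of "Suc n" "positive_word x" "Suc i" "positive_word y"] word[of "[i, i]"] 1
      by simp
    show ?case
      unfolding jones_trace_def V2 by (simp add: t_var_eq field_simps power2_eq_square)
  next
    case (2 i)
    then show ?case
      using jones_braid_R3[OF V, of "Suc n" "positive_word x" i "positive_word y"] word[of "[i, Suc i, i]"]
      by (simp add: jones_trace_def)
  next
    case (3 i j)
    then show ?case
      using jones_braid_far[OF V, of i j "Suc n" "positive_word x" "positive_word y"] word[of "[i, j]"]
      by (simp add: jones_trace_def)
  qed
qed

text \<open>Uniqueness of Markov functionals with \<open>\<mu> = 1 + t\<close>. Since only the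
  product \<open>a * b\<close> enters the value, two matrix models can be compared later.\<close>

lemma ptrace_eq_jones_trace:
  assumes V: "jones_polynomial V" and ab: "a * b = t_var" and w: "w \<in> lists {..<n}"
  shows "ptrace t_var x n (gops a b w) = t_var ^ of_bool x * jones_trace V n w"
proof (rule markov_functional_unique[OF _ _ _ _ _ _ _ w])
  let ?c = "t_var ^ of_bool x"
  show "hecke_functional (1 - t_var) t_var n (\<lambda>w. ptrace t_var x n (gops a b w))" for n
    using hecke_functional_ptrace[of a b n t_var x] by (simp add: ab)
  show "hecke_functional (1 - t_var) t_var n (\<lambda>w. ?c * jones_trace V n w)" for n
    using hecke_functional_linear[OF hecke_functional_jones_trace[OF V] hecke_functional_jones_trace[OF V],
        of n ?c 0] by simp
  show "ptrace t_var x (Suc n) (gops a b w) = (1 + t_var) * ptrace t_var x n (gops a b w)"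
    if "w \<in> lists {..<n}" for n w
    using that by (rule ptrace_Suc)
  show "?c * jones_trace V (Suc n) w = (1 + t_var) * (?c * jones_trace V n w)"
    if "w \<in> lists {..<n}" for n w
  proof -
    have "?c * jones_trace V (Suc n) w = ?c * (- t_half) ^ n * inverse (- t_half) ^ length w *
        (- t_half * V (braid_closure (Suc (Suc n)) (positive_word w)))"
      by (simp add: jones_trace_def)
    also have "\<dots> = (1 + t_var) * (?c * jones_trace V n w)"
      unfolding jones_add_strand[OF V braid_word_positive[OF that]] jones_trace_def
      by (simp only: mult_ac)
    finally show ?thesis .
  qed
  show "ptrace t_var x (Suc n) (gops a b (v @ n # w)) = ptrace t_var x n (gops a b (v @ w))"
    if "v \<in> lists {..<n}" "w \<in> lists {..<n}" for n v w
    using ptrace_markov[OF that, of a b x] by (simp add: ab)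
  show "?c * jones_trace V (Suc n) (v @ n # w) = ?c * jones_trace V n (v @ w)"
    if "v \<in> lists {..<n}" "w \<in> lists {..<n}" for n v w
    using jones_stabilization[OF V _ braid_word_positive[OF that(1)] braid_word_positive[OF that(2)],
        of "Sigma (Suc n)"]
    by (simp add: jones_trace_def)
  show "ptrace t_var x 0 (gops a b []) = ?c * jones_trace V 0 []"
    using jones_closure_one[OF V] ptrace_Nil[of t_var x a b] by (simp add: jones_trace_def)
qed

section \<open>Extension from positive words to all braid words\<close>

text \<open>A negative letter acts by \<open>a * b\<close> times the inverse of the action of the positive one.\<close>

fun letter_op :: "'a::comm_ring_1 \<Rightarrow> 'a \<Rightarrow> braid_letter \<Rightarrow> (bool list \<Rightarrow> 'a) \<Rightarrow> bool list \<Rightarrow> 'a" where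
  "letter_op a b (Sigma i) f = gop a b (i - 1) f"
| "letter_op a b (SigmaInv i) f = (\<lambda>xs. gop a b (i - 1) f xs - (1 - a * b) * f xs)"

abbreviation word_op :: "'a::comm_ring_1 \<Rightarrow> 'a \<Rightarrow> braid_letter list \<Rightarrow> (bool list \<Rightarrow> 'a) \<Rightarrow> bool list \<Rightarrow> 'a" where
  "word_op a b \<equiv> foldr (letter_op a b)"

lemma word_op_positive: "word_op a b (positive_word w) = gops a b w"
  by (induction w) simp_all

lemma letter_op_linear:
  "letter_op a b x (\<lambda>xs. c * f xs + d * g xs) xs = c * letter_op a b x f xs + d * letter_op a b x g xs"
  by (cases x) (simp_all add: gop_linear algebra_simps)

lemma word_op_linear:
  "word_op a b w (\<lambda>xs. c * f xs + d * g xs) xs = c * word_op a b w f xs + d * word_op a b w g xs"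
proof (induction w arbitrary: xs)
  case (Cons x w)
  have "word_op a b w (\<lambda>xs. c * f xs + d * g xs) = (\<lambda>xs. c * word_op a b w f xs + d * word_op a b w g xs)"
    using Cons by blast
  then show ?case by (simp add: letter_op_linear)
qed simp

lemma ptrace_negative_letter:
  "ptrace t x n (word_op a b (u @ [SigmaInv i] @ v)) =
    ptrace t x n (word_op a b (u @ [Sigma i] @ v)) - (1 - a * b) * ptrace t x n (word_op a b (u @ v))"
proof -
  have letter: "letter_op a b (SigmaInv i) g = (\<lambda>xs. 1 * gop a b (i - 1) g xs + (- (1 - a * b)) * g xs)" for g
    by (simp add: algebra_simps)
  have "word_op a b (u @ [SigmaInv i] @ v) f xs =
      word_op a b (u @ [Sigma i] @ v) f xs + (- (1 - a * b)) * word_op a b (u @ v) f xs" for f xs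
    using word_op_linear[of a b u 1 "gop a b (i - 1) (word_op a b v f)" "- (1 - a * b)" "word_op a b v f" xs]
    by (simp del: letter_op.simps(2) add: letter)
  then have "ptrace t x n (word_op a b (u @ [SigmaInv i] @ v)) = lsum n (\<lambda>xs.
      t ^ minuses (x # xs) * word_op a b (u @ [Sigma i] @ v) (delta (x # xs)) (x # xs) + (- (1 - a * b)) *
      (t ^ minuses (x # xs) * word_op a b (u @ v) (delta (x # xs)) (x # xs)))"
    unfolding ptrace_def by (intro lsum_cong) (simp only: algebra_simps)
  then show ?thesis
    unfolding lsum_add lsum_scale ptrace_def[symmetric] by (simp add: algebra_simps)
qed

text \<open>Induction on the negative letters, matching the skein relation with
  \<open>letter_op\<close>. Each negative letter costs \<open>t_half ^ 4\<close>: two half powers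
  from the normalization by the length and two from the factor \<open>t\<close> in
  \<open>t g^(-1)\<close>.\<close>

lemma jones_eq_ptrace:
  assumes V: "jones_polynomial V" and ab: "a * b = t_var" and w: "braid_word (Suc n) w"
  shows "t_half ^ (4 * negative_crossings w) * (- t_half) ^ n * t_var ^ of_bool x * V (braid_closure (Suc n) w)
    = (- t_half) ^ length w * ptrace t_var x n (word_op a b w)"
  using w
proof (induction "negative_crossings w" arbitrary: w)
  case 0
  define v where "v = map (\<lambda>x. letter_index x - 1) w"
  have "\<not> is_negative x" if "x \<in> set w" for x
    using 0(1) that by (auto simp: negative_crossings_def filter_empty_conv)
  moreover have "Sigma (Suc (letter_index x - 1)) = x" if "\<not> is_negative x" "1 \<le> letter_index x" for x
    using that by (cases x) auto
  ultimately have "map (\<lambda>x. Sigma (Suc (letter_index x - 1))) w = w"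
    using 0(2) by (intro map_idI) (auto simp: braid_word_def)
  then have wv: "w = positive_word v"
    by (simp add: v_def comp_def)
  have "v \<in> lists {..<n}"
    using 0(2) by (force simp: v_def braid_word_def in_lists_conv_set)
  have "(- t_half) ^ length w * ptrace t_var x n (word_op a b w) =
      ((- t_half) ^ length v * inverse (- t_half) ^ length v) *
      ((- t_half) ^ n * t_var ^ of_bool x * V (braid_closure (Suc n) w))"
    unfolding wv word_op_positive ptrace_eq_jones_trace[OF V ab \<open>v \<in> lists {..<n}\<close>] jones_trace_def
    by (simp only: length_map mult_ac)
  also have "(- t_half) ^ length v * inverse (- t_half) ^ length v = 1"
    by (simp only: power_mult_distrib[symmetric]) simp
  finally show ?case
    unfolding 0(1)[symmetric] by simp
next
  case (Suc l)
  have "\<exists>y\<in>set w. is_negative y"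
  proof (rule ccontr)
    assume "\<not> (\<exists>y\<in>set w. is_negative y)"
    then have "negative_crossings w = 0"
      by (simp add: negative_crossings_def filter_empty_conv)
    then show False using Suc.hyps(2) by simp
  qed
  then obtain y u v where "w = u @ y # v" "is_negative y"
    by (meson split_list)
  then obtain i where w: "w = u @ [SigmaInv i] @ v"
    by (cases y) auto
  let ?P = "\<lambda>w. ptrace t_var x n (word_op a b w)"
  let ?K = "t_half ^ (4 * l) * (- t_half) ^ n * t_var ^ of_bool x"
  have l: "negative_crossings (u @ [Sigma i] @ v) = l" "negative_crossings (u @ v) = l"
    using Suc.hyps(2) by (auto simp: w negative_crossings_def)
  have words: "braid_word (Suc n) (u @ [Sigma i] @ v)" "braid_word (Suc n) (u @ v)"
    using Suc.prems by (auto simp: w)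
  have IH1: "?K * V (braid_closure (Suc n) (u @ [Sigma i] @ v)) = (- t_half) ^ length w * ?P (u @ [Sigma i] @ v)"
    using Suc.hyps(1)[OF l(1)[symmetric] words(1)] unfolding l w by simp
  have IH2: "?K * V (braid_closure (Suc n) (u @ v)) = (- t_half) ^ (length u + length v) * ?P (u @ v)"
    using Suc.hyps(1)[OF l(2)[symmetric] words(2)] unfolding l by simp
  \<comment> \<open>\<open>P\<close>, \<open>X\<close> and \<open>M\<close> are the values for the
    positive crossing, the smoothing and the negative crossing; \<open>p\<close> and
    \<open>q\<close> are the traces for the first two.\<close>
  have skein: "s ^ 4 * (K * M) = - s * Q * (p - (1 - s * s) * q)"
    if "P = s * (s * s - 1) * X + (s * s)\<^sup>2 * M" "K * P = - s * Q * p" "K * X = Q * q"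
    for s K M P X Q p q :: "rat fls"
  proof -
    have "s ^ 4 * (K * M) = K * P - s * (s * s - 1) * (K * X)"
      unfolding that(1) by (simp add: algebra_simps power2_eq_square eval_nat_numeral)
    then show ?thesis
      unfolding that(2,3) by (simp add: algebra_simps)
  qed
  have "t_half ^ 4 * (?K * V (braid_closure (Suc n) w)) =
      - t_half * (- t_half) ^ (length u + length v) * (?P (u @ [Sigma i] @ v) - (1 - t_half * t_half) * ?P (u @ v))"
    by (rule skein[OF _ _ IH2])
      (use jones_braid_skein_positive[OF V words(1)] IH1 in \<open>simp_all add: w t_var_eq\<close>)
  also have "?P (u @ [Sigma i] @ v) - (1 - t_half * t_half) * ?P (u @ v) = ?P w"
    unfolding w ptrace_negative_letter ab t_var_eq ..
  finally have "t_half ^ 4 * (?K * V (braid_closure (Suc n) w)) = (- t_half) ^ length w * ?P w"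
    by (simp add: w)
  moreover have "t_half ^ (4 * negative_crossings w) = t_half ^ 4 * t_half ^ (4 * l)"
    unfolding Suc.hyps(2)[symmetric] by (simp add: power_add)
  ultimately show ?case
    by (simp only: mult.assoc)
qed

section \<open>Cups and the full twist\<close>

text \<open>Inserts at the positions \<open>i\<close> and \<open>i + 1\<close> the vector with
  coefficient \<open>1\<close> at \<open>False, True\<close> and \<open>s\<close> at
  \<open>True, False\<close>; \<open>cap\<close> is the transposed map.\<close>

fun cup :: "'a::comm_ring_1 \<Rightarrow> nat \<Rightarrow> (bool list \<Rightarrow> 'a) \<Rightarrow> bool list \<Rightarrow> 'a" where
  "cup s 0 h (x # y # zs) = (if x = y then 0 else if x then s * h zs else h zs)"
| "cup s (Suc i) h (x # xs) = cup s i (\<lambda>ys. h (x # ys)) xs"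
| "cup s i h xs = 0"

fun cap :: "'a::comm_ring_1 \<Rightarrow> nat \<Rightarrow> (bool list \<Rightarrow> 'a) \<Rightarrow> bool list \<Rightarrow> 'a" where
  "cap s 0 f xs = f (False # True # xs) + s * f (True # False # xs)"
| "cap s (Suc i) f (x # xs) = cap s i (\<lambda>ys. f (x # ys)) xs"
| "cap s (Suc i) f [] = 0"

lemma cup_linear: "cup s i (\<lambda>xs. c * f xs + d * g xs) xs = c * cup s i f xs + d * cup s i g xs"
proof (induction i arbitrary: f g xs)
  case 0
  then show ?case
    by (cases "(s, 0::nat, f, xs)" rule: cup.cases) (auto simp: algebra_simps)
next
  case (Suc i)
  then show ?case by (cases xs) auto
qed

text \<open>The Temperley-Lieb form \<open>g = 1 - u\<close> of the R-matrix. Equal off-diagonal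
  entries let the cup and the cap have the same coefficients.\<close>

lemma gop_eq_cup_cap: "gop s s i f xs = f xs - cup s i (cap s i f) xs"
proof (induction i arbitrary: f xs)
  case 0
  then show ?case
    by (cases "(s, s, 0::nat, f, xs)" rule: gop.cases) (auto simp: algebra_simps)
next
  case (Suc i)
  then show ?case by (cases xs) auto
qed

lemma gop_cup_same: "gop s s i (cup s i h) xs = - (s * s) * cup s i h xs"
proof (induction i arbitrary: h xs)
  case 0
  then show ?case
    by (cases "(s, s, 0::nat, h, xs)" rule: gop.cases) (auto simp: algebra_simps)
next
  case (Suc i)
  then show ?case by (cases xs) auto
qed

text \<open>Two crossings carry a strand across the cup, which shifts the cup by one
  position.\<close>

lemma gop_cup_right:
  "Suc (Suc i) < length xs \<Longrightarrow> gop s s i (gop s s (Suc i) (cup s i h)) xs = - s * cup s (Suc i) h xs"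
proof (induction i arbitrary: h xs)
  case 0
  then obtain x y z zs where "xs = x # y # z # zs"
    by (cases xs; cases "tl xs"; cases "tl (tl xs)") auto
  then show ?case by (auto simp: algebra_simps)
next
  case (Suc i)
  then show ?case by (cases xs) auto
qed

lemma gop_cup_left:
  "Suc (Suc i) < length xs \<Longrightarrow> gop s s (Suc i) (gop s s i (cup s (Suc i) h)) xs = - s * cup s i h xs"
proof (induction i arbitrary: h xs)
  case 0
  then obtain x y z zs where "xs = x # y # z # zs"
    by (cases xs; cases "tl xs"; cases "tl (tl xs)") auto
  then show ?case by (auto simp: algebra_simps)
next
  case (Suc i)
  then show ?case by (cases xs) auto
qed

lemma gop_cup_below: "Suc j < i \<Longrightarrow> gop a b j (cup s i h) = cup s i (gop a b j h)"
proof
  show "gop a b j (cup s i h) xs = cup s i (gop a b j h) xs" if "Suc j < i" for xs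
    using that
  proof (induction j arbitrary: i h xs)
    case 0
    then obtain k where i: "i = Suc (Suc k)"
      by (cases i; cases "i - 1") auto
    have "cup s k (\<lambda>zs. c * f zs - d * g zs) zs = c * cup s k f zs - d * cup s k g zs" for c d f g zs
      using cup_linear[of s k c f "- d" g zs] by simp
    moreover have "cup s k (\<lambda>zs. - (c * f zs)) zs = - (c * cup s k f zs)" for c f zs
      using cup_linear[of s k "- c" f 0 f zs] by simp
    ultimately show ?case
      unfolding i by (cases "(a, b, 0::nat, h, xs)" rule: gop.cases) auto
  next
    case (Suc j)
    then obtain k where i: "i = Suc k"
      by (cases i) auto
    show ?case
      using Suc.IH[of k] Suc.prems unfolding i by (cases xs) auto
  qed
qed

text \<open>The cup inserts two positions to the left of the crossing, hence the index shift by
  two.\<close>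

lemma gop_cup_above: "i \<le> j \<Longrightarrow> gop a b (Suc (Suc j)) (cup s i h) = cup s i (gop a b j h)"
proof
  show "gop a b (Suc (Suc j)) (cup s i h) xs = cup s i (gop a b j h) xs" if "i \<le> j" for xs
    using that
  proof (induction i arbitrary: j h xs)
    case 0
    have "gop a b j (\<lambda>zs. c * f zs) zs = c * gop a b j f zs" for c f zs
      using gop_linear[of a b j c f 0 f zs] by simp
    moreover have "gop a b j (\<lambda>zs. 0) zs = 0" for zs
      using gop_linear[of a b j 0 h 0 h zs] by simp
    ultimately show ?case
      by (cases "(s, 0::nat, h, xs)" rule: cup.cases) auto
  next
    case (Suc i)
    then obtain k where j: "j = Suc k"
      by (cases j) auto
    show ?case
      using Suc.IH[of k] Suc.prems unfolding j by (cases xs) auto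
  qed
qed

lemma gops_cup_below: "w \<in> lists {..<i} \<Longrightarrow> gops a b w (cup s (Suc i) h) = cup s (Suc i) (gops a b w h)"
  by (induction w rule: list.induct) (auto simp: gop_cup_below)

lemma gops_cup_above:
  "w \<in> lists {i..} \<Longrightarrow> gops a b (map (\<lambda>j. Suc (Suc j)) w) (cup s i h) = cup s i (gops a b w h)"
  by (induction w rule: list.induct) (auto simp: gop_cup_above)

lemma gop_gops_far:
  "w \<in> lists {..<n} \<Longrightarrow> gop a b (Suc n) (gops a b w f) xs = gops a b w (gop a b (Suc n) f) xs"
proof (induction w arbitrary: xs rule: list.induct)
  case (Cons i w)
  then have "gop a b (Suc n) (gops a b (i # w) f) xs = gop a b i (gop a b (Suc n) (gops a b w f)) xs"
    using gop_far[of i "Suc n" a b "gops a b w f" xs] by auto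
  also have "\<dots> = gops a b (i # w) (gop a b (Suc n) f) xs"
    using Cons by (auto intro!: gop_cong)
  finally show ?case .
qed simp

text \<open>Letters to the right of the cup pass it with shifted indices, then \<open>Suc i\<close>
  and \<open>i\<close> move it one place to the right, then the letters to the left pass it. What
  passes is one sweep on two strands fewer.\<close>

lemma gops_cup_shift:
  assumes "Suc i \<le> m" "length xs = Suc (Suc m)"
  shows "gops s s [0..<Suc m] (cup s i h) xs = - s * cup s (Suc i) (gops s s [0..<m - 1] h) xs"
proof -
  have upt: "[0..<Suc m] = [0..<i] @ [i, Suc i] @ map (\<lambda>j. Suc (Suc j)) [i..<m - 1]"
  proof -
    have "map (\<lambda>j. Suc (Suc j)) [i..<m - 1] = map Suc (map Suc [i..<m - 1])" by simp
    also have "\<dots> = [Suc (Suc i)..<Suc m]"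
      unfolding map_Suc_upt using assms(1) by simp
    finally show ?thesis
      using assms(1) upt_add_eq_append[of 0 i "Suc m - i"]
      by (simp add: upt_conv_Cons[of i] upt_conv_Cons[of "Suc i"] del: upt_Suc)
  qed
  let ?h = "gops s s [i..<m - 1] h"
  have "gops s s [0..<Suc m] (cup s i h) xs = gops s s [0..<i] (gop s s i (gop s s (Suc i) (cup s i ?h))) xs"
    unfolding upt by (simp add: gops_cup_above in_lists_conv_set)
  also have "\<dots> = gops s s [0..<i] (\<lambda>xs. - s * cup s (Suc i) ?h xs) xs"
    by (intro gops_cong gop_cup_right) (use assms in simp)
  also have "\<dots> = - s * gops s s [0..<i] (cup s (Suc i) ?h) xs"
    by (rule gops_scale)
  also have "gops s s [0..<i] (cup s (Suc i) ?h) = cup s (Suc i) (gops s s ([0..<i] @ [i..<m - 1]) h)"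
    by (simp add: gops_cup_below in_lists_conv_set)
  also have "[0..<i] @ [i..<m - 1] = [0..<m - 1]"
    using assms(1) upt_add_eq_append[of 0 i "m - 1 - i"] by simp
  finally show ?thesis .
qed

text \<open>The last letter of the left block commutes past all but the last letter of the right
  block, and these two move the cup one place to the left. At position \<open>0\<close> a single
  letter remains and gives the eigenvalue \<open>- (s * s)\<close>.\<close>

lemma gops_cup_slide:
  "Suc (Suc m) \<le> length xs \<Longrightarrow>
    gops s s ([0..<Suc m] @ [0..<m]) (cup s m h) xs = (- s) ^ m * (- (s * s)) * cup s 0 h xs"
proof (induction m)
  case 0
  then show ?case by (simp add: gop_cup_same)
next
  case (Suc m)
  have "gops s s ([0..<Suc (Suc m)] @ [0..<Suc m]) (cup s (Suc m) h) xs =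
      gops s s [0..<Suc m] (gop s s (Suc m) (gops s s [0..<m] (gop s s m (cup s (Suc m) h)))) xs"
    by simp
  also have "\<dots> = gops s s [0..<Suc m] (gops s s [0..<m] (gop s s (Suc m) (gop s s m (cup s (Suc m) h)))) xs"
    by (intro gops_cong gop_gops_far) (simp add: in_lists_conv_set)
  also have "\<dots> = gops s s [0..<Suc m] (gops s s [0..<m] (\<lambda>xs. - s * cup s m h xs)) xs"
    by (intro gops_cong gop_cup_left) (use Suc.prems in simp)
  also have "\<dots> = gops s s ([0..<Suc m] @ [0..<m]) (\<lambda>xs. - s * cup s m h xs) xs"
    by simp
  also have "\<dots> = - s * gops s s ([0..<Suc m] @ [0..<m]) (cup s m h) xs"
    by (rule gops_scale)
  also have "\<dots> = (- s) ^ Suc m * (- (s * s)) * cup s 0 h xs"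
    using Suc by simp
  finally show ?case .
qed

section \<open>A cup pulled through the full twist on \<open>m + 2\<close> strands\<close>

definition twist_word :: "nat \<Rightarrow> nat list" where
  "twist_word m = concat (replicate (Suc (Suc m)) [0..<Suc m])"

lemma gops_cup_shift_power:
  assumes "i + k \<le> m" "length xs = Suc (Suc m)"
  shows "gops s s (concat (replicate k [0..<Suc m])) (cup s i h) xs =
    (- s) ^ k * cup s (i + k) (gops s s (concat (replicate k [0..<m - 1])) h) xs"
  using assms
proof (induction k arbitrary: xs)
  case (Suc k)
  let ?h = "gops s s (concat (replicate k [0..<m - 1])) h"
  have "gops s s (concat (replicate (Suc k) [0..<Suc m])) (cup s i h) xs =
      gops s s [0..<Suc m] (gops s s (concat (replicate k [0..<Suc m])) (cup s i h)) xs"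
    by simp
  also have "\<dots> = gops s s [0..<Suc m] (\<lambda>xs. (- s) ^ k * cup s (i + k) ?h xs) xs"
    using Suc by (intro gops_cong) auto
  also have "\<dots> = (- s) ^ k * gops s s [0..<Suc m] (cup s (i + k) ?h) xs"
    by (rule gops_scale)
  also have "\<dots> = (- s) ^ Suc k * cup s (i + Suc k) (gops s s [0..<m - 1] ?h) xs"
    using gops_cup_shift[of "i + k" m xs s ?h] Suc.prems by simp
  finally show ?case by simp
qed simp

text \<open>
  The \<open>i\<close>-th cup is carried around the whole braid: \<open>m - i\<close> factors of the full twist move it
  to the right end, two factors move it to the left end and \<open>i\<close> factors move it back.
\<close>

lemma twist_cup:
  assumes "i \<le> m" "length xs = Suc (Suc m)"
  shows "gops s s (twist_word m) (cup s i h) xs =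
    s ^ (2 * Suc (Suc m)) * cup s i (gops s s (concat (replicate m [0..<m - 1])) h) xs"
proof -
  let ?D = "\<lambda>k. concat (replicate k [0..<Suc m])" and ?D' = "\<lambda>k. concat (replicate k [0..<m - 1])"
  let ?h = "gops s s (?D' (m - i)) h"
  have split: "twist_word m = ?D i @ ?D 2 @ ?D (m - i)"
    using assms(1) unfolding twist_word_def concat_append[symmetric] replicate_add[symmetric] by simp
  \<comment> \<open>The last letter of the two sweeps acts first and meets the cup at the right end,
    giving one eigenvalue \<open>- (s * s)\<close>; the other letters form the word of
    \<open>gops_cup_slide\<close>.\<close>
  have full_turn: "gops s s (?D 2) (cup s m ?h) ys = (- s) ^ m * (s ^ 4) * cup s 0 ?h ys"
    if "length ys = Suc (Suc m)" for ys
  proof -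
    have "gops s s (?D 2) (cup s m ?h) ys = gops s s ([0..<Suc m] @ [0..<m]) (gop s s m (cup s m ?h)) ys"
      by (simp add: numeral_2_eq_2)
    also have "\<dots> = gops s s ([0..<Suc m] @ [0..<m]) (\<lambda>ys. - (s * s) * cup s m ?h ys) ys"
      by (intro gops_cong gop_cup_same)
    also have "\<dots> = - (s * s) * gops s s ([0..<Suc m] @ [0..<m]) (cup s m ?h) ys"
      by (rule gops_scale)
    also have "\<dots> = (- s) ^ m * (s ^ 4) * cup s 0 ?h ys"
      using that by (subst gops_cup_slide) (simp_all add: eval_nat_numeral)
    finally show ?thesis .
  qed
  have "gops s s (twist_word m) (cup s i h) xs =
      gops s s (?D i) (gops s s (?D 2) (gops s s (?D (m - i)) (cup s i h))) xs"
    by (simp add: split)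
  also have "\<dots> = gops s s (?D i) (gops s s (?D 2) (\<lambda>xs. (- s) ^ (m - i) * cup s m ?h xs)) xs"
    using gops_cup_shift_power[of i "m - i" m _ s h] assms by (intro gops_cong) auto
  also have "\<dots> = (- s) ^ (m - i) * gops s s (?D i) (gops s s (?D 2) (cup s m ?h)) xs"
    by (simp only: gops_scale[abs_def])
  also have "gops s s (?D i) (gops s s (?D 2) (cup s m ?h)) xs =
      gops s s (?D i) (\<lambda>ys. (- s) ^ m * (s ^ 4) * cup s 0 ?h ys) xs"
    using assms by (intro gops_cong full_turn) simp
  also have "\<dots> = (- s) ^ m * (s ^ 4) * ((- s) ^ i * cup s i (gops s s (?D' i) ?h) xs)"
    using gops_cup_shift_power[of 0 i m xs s ?h] assms by (simp only: gops_scale) simp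
  \<comment> \<open>The sweeps left over from both stages combine to the full twist on
    \<open>m\<close> strands.\<close>
  also have "gops s s (?D' i) ?h = gops s s (?D' m) h"
    using assms(1) unfolding o_apply[symmetric, of "gops s s _"] foldr_append[symmetric]
      concat_append[symmetric] replicate_add[symmetric] by simp
  also have "(- s) ^ (m - i) * ((- s) ^ m * s ^ 4 * ((- s) ^ i * c)) = s ^ (2 * Suc (Suc m)) * c" for c
  proof -
    have "(- s) ^ (m - i) * ((- s) ^ m * s ^ 4 * ((- s) ^ i * c)) = (- s) ^ (m - i + i + m) * s ^ 4 * c"
      by (simp only: power_add mult_ac)
    also have "(- s) ^ (m - i + i + m) = s ^ (2 * m)"
      using assms(1) by (simp add: mult_2[symmetric])
    also have "s ^ (2 * m) * s ^ 4 = s ^ (2 * Suc (Suc m))"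
      by (simp add: eval_nat_numeral)
    finally show ?thesis .
  qed
  finally show ?thesis .
qed

section \<open>Integrality and divisibility by powers of \<open>t\<close>\<close>

text \<open>The multiples of the \<open>k\<close>-th power of \<open>t_half\<close> in the power
  series ring; \<open>k\<close> counts half powers, so exponents of \<open>t\<close> appear
  doubled.\<close>

definition power_ideal :: "nat \<Rightarrow> rat fls set" where
  "power_ideal k = range (\<lambda>f. t_half ^ k * fps_to_fls f)"

lemma power_ideal_0: "0 \<in> power_ideal k"
  unfolding power_ideal_def by (rule range_eqI[of _ _ 0]) simp

lemma power_ideal_add: "x \<in> power_ideal k \<Longrightarrow> y \<in> power_ideal k \<Longrightarrow> x + y \<in> power_ideal k"
  unfolding power_ideal_def by (auto simp: image_iff intro: exI[of _ "_ + _"] simp flip: distrib_left fps_to_fls_plus)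

lemma power_ideal_uminus: "x \<in> power_ideal k \<Longrightarrow> - x \<in> power_ideal k"
  unfolding power_ideal_def by (auto simp: image_iff simp flip: mult_minus_right fps_to_fls_uminus)

lemma power_ideal_diff: "x \<in> power_ideal k \<Longrightarrow> y \<in> power_ideal k \<Longrightarrow> x - y \<in> power_ideal k"
  using power_ideal_add[of x k "- y"] power_ideal_uminus by simp

lemma power_ideal_mult: "x \<in> power_ideal j \<Longrightarrow> y \<in> power_ideal k \<Longrightarrow> x * y \<in> power_ideal (j + k)"
proof -
  assume "x \<in> power_ideal j" "y \<in> power_ideal k"
  then obtain f g where "x = t_half ^ j * fps_to_fls f" "y = t_half ^ k * fps_to_fls g"
    unfolding power_ideal_def by auto
  then have "x * y = t_half ^ (j + k) * fps_to_fls (f * g)"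
    by (simp add: power_add fls_times_fps_to_fls mult_ac)
  then show ?thesis
    unfolding power_ideal_def by simp
qed

lemma power_ideal_mult_0: "x \<in> power_ideal 0 \<Longrightarrow> y \<in> power_ideal k \<Longrightarrow> x * y \<in> power_ideal k"
  using power_ideal_mult[of x 0 y k] by simp

lemma fps_to_fls_in_power_ideal: "fps_to_fls f \<in> power_ideal 0"
  unfolding power_ideal_def by simp

lemma power_ideal_1: "1 \<in> power_ideal 0"
  using fps_to_fls_in_power_ideal[of 1] by simp

lemma t_half_power_in_power_ideal: "k \<le> j \<Longrightarrow> t_half ^ j \<in> power_ideal k"
  unfolding power_ideal_def
  by (rule range_eqI[of _ _ "fps_X ^ (j - k)"])
    (simp add: fps_to_fls_power t_half_def flip: power_add)

lemma t_half_in_power_ideal: "t_half \<in> power_ideal 0"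
  using t_half_power_in_power_ideal[of 0 1] by simp

lemma t_var_power: "t_var ^ k = t_half ^ (2 * k)"
  by (simp add: t_var_def power_mult)

lemma t_var_power_in_power_ideal: "k \<le> 2 * j \<Longrightarrow> t_var ^ j \<in> power_ideal k"
  unfolding t_var_power by (rule t_half_power_in_power_ideal)

lemma lsum_closed:
  assumes "0 \<in> S" "\<And>x y. x \<in> S \<Longrightarrow> y \<in> S \<Longrightarrow> x + y \<in> S"
    and "\<And>xs. length xs = n \<Longrightarrow> f xs \<in> S"
  shows "lsum n f \<in> S"
  using assms(3) by (induction n arbitrary: f) (auto intro: assms(2))

lemma lsum_diff: "lsum n (\<lambda>xs. f xs - g xs) = lsum n f - lsum n g"
  using lsum_add[of n f "\<lambda>xs. - 1 * g xs"] unfolding lsum_scale by simp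

lemma lsum_sum: "lsum n (\<lambda>xs. \<Sum>k\<in>A. f k xs) = (\<Sum>k\<in>A. lsum n (f k))"
  by (induction n arbitrary: f) (simp_all add: sum.distrib)

lemma lsum_delta:
  fixes c :: "bool list \<Rightarrow> 'a::comm_ring_1"
  shows "length ys = n \<Longrightarrow> lsum n (\<lambda>xs. c xs * delta ys xs) = c ys"
proof (induction n arbitrary: ys c)
  case (Suc n)
  then obtain y zs where ys: "ys = y # zs" "length zs = n"
    by (cases ys) auto
  have "(delta (y # zs) (x # xs) :: 'a) = (if x = y then delta zs xs else 0)" for x xs
    by (simp add: delta_def)
  then show ?case
    using Suc.IH[OF ys(2), of "\<lambda>zs. c (y # zs)"] lsum_scale[of n 0 "\<lambda>_. 0"]
    by (cases y) (simp_all add: ys(1))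
qed (simp add: delta_def)

text \<open>The set \<open>S\<close> is left abstract to serve both divisibility, in the model
  \<open>a = b = t_half\<close>, and integrality, in the model \<open>a = 1\<close>,
  \<open>b = t_var\<close>.\<close>

lemma gop_closed:
  assumes add: "\<And>x y. x \<in> S \<Longrightarrow> y \<in> S \<Longrightarrow> x + y \<in> S" and minus: "\<And>x. x \<in> S \<Longrightarrow> - x \<in> S"
    and scale: "\<And>x. x \<in> S \<Longrightarrow> a * x \<in> S" "\<And>x. x \<in> S \<Longrightarrow> b * x \<in> S"
    and f: "\<And>ys. f ys \<in> S"
  shows "gop a b i f xs \<in> S"
  using f
proof (induction i arbitrary: f xs)
  case 0
  have "- (a * f ys) \<in> S" for ys
    by (intro minus scale 0)
  moreover have "(1 - a * b) * f ys - b * f zs \<in> S" for ys zs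
  proof -
    have "f ys + (- (a * (b * f ys)) + - (b * f zs)) \<in> S"
      by (intro add minus scale 0)
    then show ?thesis by (simp add: algebra_simps)
  qed
  ultimately show ?case
    using 0 by (cases "(a, b, 0::nat, f, xs)" rule: gop.cases) auto
next
  case (Suc i)
  then show ?case by (cases xs) auto
qed

lemma word_op_closed:
  assumes add: "\<And>x y. x \<in> S \<Longrightarrow> y \<in> S \<Longrightarrow> x + y \<in> S" and minus: "\<And>x. x \<in> S \<Longrightarrow> - x \<in> S"
    and scale: "\<And>x. x \<in> S \<Longrightarrow> a * x \<in> S" "\<And>x. x \<in> S \<Longrightarrow> b * x \<in> S"
    and f: "\<And>ys. f ys \<in> S"
  shows "word_op a b w f xs \<in> S"
  using f
proof (induction w arbitrary: xs)
  case (Cons x w)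
  let ?g = "word_op a b w f"
  have g: "?g ys \<in> S" for ys
    using Cons by blast
  have gop: "gop a b i ?g xs \<in> S" for i xs
    by (rule gop_closed[OF add minus scale]) (use g in auto)
  have "gop a b i ?g xs + (- ?g xs + a * (b * ?g xs)) \<in> S" for i xs
    by (intro add minus scale g gop)
  then have "gop a b i ?g xs - (1 - a * b) * ?g xs \<in> S" for i xs
    by (simp add: algebra_simps)
  then show ?case
    using gop by (cases x) auto
qed simp

lemma cap_closed:
  assumes "\<And>x y. x \<in> S \<Longrightarrow> y \<in> S \<Longrightarrow> x + y \<in> S" "\<And>x. x \<in> S \<Longrightarrow> s * x \<in> S" "0 \<in> S"
    and "\<And>ys. f ys \<in> S"
  shows "cap s i f xs \<in> S"
  using assms(4)
proof (induction i arbitrary: f xs)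
  case 0
  then show ?case by (auto intro: assms(1-3))
next
  case (Suc i)
  then show ?case by (cases xs) (auto intro: assms(3))
qed

lemma cup_closed:
  assumes "\<And>x. x \<in> S \<Longrightarrow> s * x \<in> S" "0 \<in> S" "\<And>ys. h ys \<in> S"
  shows "cup s i h xs \<in> S"
  using assms(3)
proof (induction i arbitrary: h xs)
  case 0
  then show ?case
    by (cases "(s, 0::nat, h, xs)" rule: cup.cases) (auto intro: assms(1,2))
next
  case (Suc i)
  then show ?case by (cases xs) (auto intro: assms(2))
qed

lemma gops_power_ideal:
  assumes "\<And>ys. f ys \<in> power_ideal k"
  shows "gops t_half t_half w f xs \<in> power_ideal k"
  unfolding word_op_positive[symmetric]
  by (rule word_op_closed)
    (auto intro: power_ideal_add power_ideal_uminus power_ideal_mult_0 t_half_in_power_ideal assms)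

section \<open>Operators modulo the images of cups\<close>

text \<open>
  The number of strands is \<open>m + 2\<close>; images of cups are small because of \<open>twist_cup\<close>.
\<close>

definition twist_small :: "nat \<Rightarrow> (bool list \<Rightarrow> rat fls) \<Rightarrow> bool" where
  "twist_small m f \<longleftrightarrow> (\<forall>xs. length xs = Suc (Suc m) \<longrightarrow>
     gops t_half t_half (twist_word m) f xs \<in> power_ideal (2 * Suc (Suc m)))"

lemma twist_small_linear:
  assumes "twist_small m f" "twist_small m g" "c \<in> power_ideal 0" "d \<in> power_ideal 0"
  shows "twist_small m (\<lambda>xs. c * f xs + d * g xs)"
  using assms unfolding twist_small_def gops_linear by (blast intro: power_ideal_add power_ideal_mult_0)

text \<open>By \<open>twist_cup\<close> a scalar \<open>t^n\<close> with \<open>n = m + 2\<close>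
  splits off, and the remaining coefficients are power series.\<close>

lemma twist_small_cup:
  assumes "i \<le> m" "\<And>ys. h ys \<in> power_ideal 0"
  shows "twist_small m (cup t_half i h)"
proof -
  have "cup t_half i (gops t_half t_half w h) xs \<in> power_ideal 0" for w xs
    by (rule cup_closed)
      (auto intro: power_ideal_0 power_ideal_mult_0 t_half_in_power_ideal gops_power_ideal assms(2))
  then have "t_half ^ k * cup t_half i (gops t_half t_half w h) xs \<in> power_ideal k" for k w xs
    using power_ideal_mult[OF t_half_power_in_power_ideal[OF order_refl, of k], of _ 0] by simp
  then show ?thesis
    unfolding twist_small_def by (auto simp only: twist_cup[OF assms(1)])
qed

text \<open>Modulo the images of the cups, a positive crossing acts as \<open>1\<close> and a negative one as \<open>t\<close>.\<close>

lemma twist_small_word: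
  assumes "braid_word (Suc (Suc m)) w" "\<And>ys. f ys \<in> power_ideal 0"
  shows "twist_small m (\<lambda>xs. word_op t_half t_half w f xs - t_var ^ negative_crossings w * f xs)"
  using assms(1)
proof (induction w)
  case Nil
  have "gops t_half t_half v (\<lambda>_. 0) xs = 0" for v xs
    by (rule gops_zero)
  then show ?case
    by (simp add: twist_small_def negative_crossings_def power_ideal_0)
next
  case (Cons x w)
  let ?i = "letter_index x - 1"
  define g where "g = word_op t_half t_half w f"
  have word: "word_op t_half t_half w f xs \<in> power_ideal 0" for xs
    by (rule word_op_closed)
      (auto intro: power_ideal_add power_ideal_uminus power_ideal_mult_0 t_half_in_power_ideal assms(2))
  have small_cup: "twist_small m (cup t_half ?i (cap t_half ?i g))"
  proof (rule twist_small_cup)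
    show "?i \<le> m" using Cons.prems by auto
    show "cap t_half ?i g ys \<in> power_ideal 0" for ys
      by (rule cap_closed)
        (auto intro: power_ideal_0 power_ideal_add power_ideal_mult_0 t_half_in_power_ideal simp: g_def word)
  qed
  have IH: "twist_small m (\<lambda>xs. g xs - t_var ^ negative_crossings w * f xs)"
    using Cons by (simp add: g_def)
  \<comment> \<open>Letters of either sign subtract the same cup image and differ only in this
    scalar.\<close>
  define c where "c = (if is_negative x then t_var else 1)"
  have c: "c \<in> power_ideal 0"
    using power_ideal_1 t_var_power_in_power_ideal[of 0 1] by (simp add: c_def)
  have "word_op t_half t_half (x # w) f xs - t_var ^ negative_crossings (x # w) * f xs =
      c * (g xs - t_var ^ negative_crossings w * f xs) + (- 1) * cup t_half ?i (cap t_half ?i g) xs" for xs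
    by (cases x) (simp_all add: c_def negative_crossings_def gop_eq_cup_cap algebra_simps t_var_eq flip: g_def)
  then show ?case
    using twist_small_linear[OF IH small_cup c power_ideal_uminus[OF power_ideal_1]] by simp
qed

text \<open>Counts the pairs with \<open>False\<close> before \<open>True\<close>. It is the
  exponent of \<open>- t_half\<close> both in reducing a state to the sorted one and in the covector
  that vanishes on cups.\<close>

fun inversions :: "bool list \<Rightarrow> nat" where
  "inversions [] = 0"
| "inversions (x # xs) = (if x then 0 else minuses xs) + inversions xs"

lemma inversions_swap: "inversions (p @ False # True # q) = Suc (inversions (p @ True # False # q))"
  by (induction p) auto

lemma inversions_cases:
  obtains "xs = replicate (minuses xs) True @ replicate (length xs - minuses xs) False"
  | p q where "xs = p @ False # True # q"
proof -
  have "xs = replicate (minuses xs) True @ replicate (length xs - minuses xs) False \<or>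
    (\<exists>p q. xs = p @ False # True # q)"
  proof (induction xs)
    case (Cons x xs)
    then consider "xs = replicate (minuses xs) True @ replicate (length xs - minuses xs) False"
      | p q where "xs = p @ False # True # q" by blast
    then show ?case
    proof cases
      case 1
      show ?thesis
      proof (cases "x \<or> minuses xs = 0")
        case True
        then show ?thesis using 1 by auto
      next
        case False
        then obtain k where k: "minuses xs = Suc k"
          by (cases "minuses xs") auto
        have "x # xs = [] @ False # True # replicate k True @ replicate (length xs - minuses xs) False"
          using False by (subst (1) 1) (simp add: k)
        then show ?thesis by blast
      qed
    next
      case 2
      then have "x # xs = (x # p) @ False # True # q" by simp
      then show ?thesis by blast
    qed
  qed simp
  then show thesis using that by blast
qed

definition sorted_state :: "nat \<Rightarrow> nat \<Rightarrow> bool list" where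
  "sorted_state n k = replicate k True @ replicate (n - k) False"

lemma cup_zero: "cup s i (\<lambda>_. 0) xs = 0"
  using cup_linear[of s i 0 "\<lambda>_. 0" 0 "\<lambda>_. 0" xs] by simp

lemma delta_Cons:
  "delta (y # ys) (x # xs) = (if x = y then delta ys xs else 0)" "delta (y # ys) [] = 0"
  by (simp_all add: delta_def)

text \<open>The images of basis vectors are the relations that, modulo cups, replace
  \<open>False, True\<close> by \<open>- s\<close> times \<open>True, False\<close>.\<close>

lemma cup_delta:
  fixes s :: "'a::comm_ring_1"
  shows "cup s (length p) (delta (p @ q)) xs = delta (p @ False # True # q) xs + s * delta (p @ True # False # q) xs"
proof (induction p arbitrary: xs)
  case Nil
  show ?case
    by (cases "(s, 0::nat, delta q :: bool list \<Rightarrow> 'a, xs)" rule: cup.cases) (auto simp: delta_def)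
next
  case (Cons y p)
  note IH = Cons.IH
  show ?case
  proof (cases xs)
    case (Cons z zs)
    then show ?thesis
      using IH[of zs] by (cases "z = y") (simp_all add: delta_Cons cup_zero)
  qed (simp add: delta_Cons)
qed

lemma delta_in_power_ideal: "delta xs ys \<in> power_ideal 0"
  by (simp add: delta_def power_ideal_0 power_ideal_1)

text \<open>Modulo the images of the cups, every weight space has rank one.\<close>

lemma twist_small_delta:
  assumes "length xs = Suc (Suc m)"
  shows "twist_small m (\<lambda>ys. delta xs ys -
    (- t_half) ^ inversions xs * delta (sorted_state (Suc (Suc m)) (minuses xs)) ys)"
  using assms
proof (induction "inversions xs" arbitrary: xs rule: less_induct)
  case less
  have inv_sorted: "inversions (replicate k True @ replicate j False) = 0" for k j
  proof -
    have "minuses (replicate j False) = 0" for j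
      by (simp add: count_list_0_iff)
    then have "inversions (replicate j False) = 0"
      by (induction j) auto
    then show ?thesis by (induction k) auto
  qed
  show ?case
  proof (cases xs rule: inversions_cases)
    case 1
    then have "sorted_state (Suc (Suc m)) (minuses xs) = xs" "inversions xs = 0"
      using less.prems inv_sorted[of "minuses xs" "length xs - minuses xs"] by (simp_all add: sorted_state_def)
    then show ?thesis
      by (simp add: twist_small_def gops_zero power_ideal_0)
  next
    case (2 p q)
    let ?ys = "p @ True # False # q" and ?d = "delta (sorted_state (Suc (Suc m)) (minuses xs))"
    have inv: "inversions xs = Suc (inversions ?ys)" "minuses xs = minuses ?ys"
      unfolding 2 by (simp_all add: inversions_swap)
    have "twist_small m (\<lambda>zs. delta ?ys zs - (- t_half) ^ inversions ?ys * ?d zs)"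
      unfolding inv(2) using less.prems by (intro less.hyps) (simp_all add: 2 inversions_swap)
    moreover have "twist_small m (cup t_half (length p) (delta (p @ q)))"
      using less.prems by (intro twist_small_cup) (simp_all add: 2 delta_in_power_ideal)
    \<comment> \<open>Subtracting the cup trades \<open>xs\<close> for \<open>?ys\<close>, which has
      one inversion fewer, at the cost of a factor \<open>- t_half\<close>.\<close>
    moreover have "delta xs zs - (- t_half) ^ inversions xs * ?d zs =
        (- t_half) * (delta ?ys zs - (- t_half) ^ inversions ?ys * ?d zs) +
        1 * cup t_half (length p) (delta (p @ q)) zs" for zs
      unfolding cup_delta inv(1) unfolding 2 by (simp add: algebra_simps)
    ultimately show ?thesis
      using twist_small_linear[of m _ _ "- t_half" 1] power_ideal_1 power_ideal_uminus[OF t_half_in_power_ideal]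
      by simp
  qed
qed

section \<open>The trace of the full twist modulo a power of \<open>t\<close>\<close>

text \<open>The hypothesis says that the covector \<open>c\<close> vanishes on images of cups, and a
  crossing is \<open>1\<close> minus such an image.\<close>

lemma lsum_gop_invariant:
  assumes "\<And>p q. c (p @ False # True # q) = - s * c (p @ True # False # q)"
  shows "lsum n (\<lambda>xs. c xs * gop s s i f xs) = lsum n (\<lambda>xs. c xs * f xs)"
  using assms
proof (induction i arbitrary: c n f)
  case 0
  show ?case
  proof (cases n)
    case (Suc k)
    show ?thesis
    proof (cases k)
      case (Suc j)
      have "c (False # True # xs) = - s * c (True # False # xs)" for xs
        using 0[of "[]" xs] by simp
      then have eq: "c (False # True # xs) * gop s s 0 f (False # True # xs) + c (True # False # xs) * gop s s 0 f (True # False # xs)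
          = c (False # True # xs) * f (False # True # xs) + c (True # False # xs) * f (True # False # xs)" for xs
        by (simp add: algebra_simps)
      have "lsum j (\<lambda>xs. c (False # True # xs) * gop s s 0 f (False # True # xs)) +
          lsum j (\<lambda>xs. c (True # False # xs) * gop s s 0 f (True # False # xs)) =
          lsum j (\<lambda>xs. c (False # True # xs) * f (False # True # xs)) +
          lsum j (\<lambda>xs. c (True # False # xs) * f (True # False # xs))"
        unfolding lsum_add[symmetric] eq ..
      then show ?thesis
        unfolding \<open>n = Suc k\<close> \<open>k = Suc j\<close> by (simp del: gop.simps(1) add: gop.simps(1)[of _ _ _ False False] gop.simps(1)[of _ _ _ True True] algebra_simps)
    qed (simp add: \<open>n = Suc k\<close>)
  qed simp
next
  case (Suc i)
  show ?case
  proof (cases n)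
    case (Suc k)
    have "lsum k (\<lambda>xs. c (x # xs) * gop s s i (\<lambda>ys. f (x # ys)) xs) = lsum k (\<lambda>xs. c (x # xs) * f (x # xs))" for x
      by (rule Suc.IH) (use Suc.prems[of "x # _"] in simp)
    then show ?thesis
      by (simp add: \<open>n = Suc k\<close>)
  qed simp
qed

lemma lsum_gops_invariant:
  assumes "\<And>p q. c (p @ False # True # q) = - s * c (p @ True # False # q)"
  shows "lsum n (\<lambda>xs. c xs * gops s s w f xs) = lsum n (\<lambda>xs. c xs * f xs)"
  by (induction w) (simp_all add: lsum_gop_invariant[OF assms])

text \<open>In the row of the R-matrix for equal neighbours only the diagonal entry \<open>1\<close>
  is nonzero.\<close>

lemma gops_all_False: "gops a b w f (replicate n False) = f (replicate n False)"
proof -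
  have "gop a b i g (replicate n False) = g (replicate n False)" for i g
  proof (induction i arbitrary: g n)
    case 0
    then show ?case by (cases n; cases "n - 1") auto
  next
    case (Suc i)
    then show ?case by (cases n) auto
  qed
  then show ?thesis by (induction w) simp_all
qed

lemma word_op_all_False:
  "word_op a b w f (replicate n False) = (a * b) ^ negative_crossings w * f (replicate n False)"
proof (induction w)
  case (Cons x w)
  have "gop a b i g (replicate n False) = g (replicate n False)" for i g
    using gops_all_False[of a b "[i]" g n] by simp
  with Cons show ?case
    by (cases x) (simp_all add: negative_crossings_def algebra_simps)
qed (simp add: negative_crossings_def)

lemma inversions_all_False: "inversions (replicate n False) = 0"
proof (induction n)
  case (Suc n)
  then show ?case by (simp add: count_list_0_iff)
qed simp

text \<open>Group the states by weight. In each weight the sum pairs an invariant covector with the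
  image of the sorted state, which gives its value there, namely \<open>1\<close>.\<close>

lemma lsum_twist:
  "lsum (Suc (Suc m)) (\<lambda>xs. t_var ^ minuses xs * ((- t_half) ^ inversions xs *
      gops t_half t_half w (delta (sorted_state (Suc (Suc m)) (minuses xs))) xs)) = (\<Sum>k\<le>Suc (Suc m). t_var ^ k)"
proof -
  let ?n = "Suc (Suc m)"
  let ?g = "\<lambda>k. gops t_half t_half w (delta (sorted_state ?n k))"
  define c where "c k xs = (if minuses xs = k then (- t_half) ^ inversions xs else 0)" for k xs
  have "lsum ?n (\<lambda>xs. t_var ^ minuses xs * ((- t_half) ^ inversions xs * ?g (minuses xs) xs)) =
      lsum ?n (\<lambda>xs. \<Sum>k\<le>?n. t_var ^ k * (c k xs * ?g k xs))"
  proof (rule lsum_cong)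
    fix xs :: "bool list" assume "length xs = ?n"
    then have "minuses xs \<le> ?n"
      using count_le_length[of xs True] by simp
    then have "(\<Sum>k\<le>?n. t_var ^ k * (c k xs * ?g k xs)) =
        (\<Sum>k\<le>?n. if k = minuses xs then t_var ^ k * ((- t_half) ^ inversions xs * ?g k xs) else 0)"
      by (intro sum.cong) (auto simp: c_def)
    then show "t_var ^ minuses xs * ((- t_half) ^ inversions xs * ?g (minuses xs) xs) =
        (\<Sum>k\<le>?n. t_var ^ k * (c k xs * ?g k xs))"
      using \<open>minuses xs \<le> ?n\<close> by simp
  qed
  also have "\<dots> = (\<Sum>k\<le>?n. t_var ^ k * lsum ?n (\<lambda>xs. c k xs * ?g k xs))"
    unfolding lsum_sum lsum_scale ..
  also have "\<dots> = (\<Sum>k\<le>?n. t_var ^ k)"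
  proof (rule sum.cong)
    fix k assume k: "k \<in> {..?n}"
    \<comment> \<open>Cutting the covector down to one weight keeps it invariant, as a swap
      preserves the number of \<open>True\<close>.\<close>
    have "lsum ?n (\<lambda>xs. c k xs * ?g k xs) = lsum ?n (\<lambda>xs. c k xs * delta (sorted_state ?n k) xs)"
      by (rule lsum_gops_invariant) (simp add: c_def inversions_swap)
    also have "\<dots> = c k (sorted_state ?n k)"
      using k by (intro lsum_delta) (simp add: sorted_state_def)
    also have "\<dots> = 1"
    proof -
      have "minuses (replicate k True) = k" for k
        by (induction k) auto
      moreover have "minuses (replicate j False) = 0" for j
        by (simp add: count_list_0_iff)
      moreover have "inversions (replicate k True @ replicate j False) = 0" for k j
        by (induction k) (simp_all add: inversions_all_False)
      ultimately show ?thesis by (simp add: c_def sorted_state_def)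
    qed
    finally show "t_var ^ k * lsum ?n (\<lambda>xs. c k xs * ?g k xs) = t_var ^ k" by simp
  qed simp
  finally show ?thesis .
qed

text \<open>On \<open>n = m + 2\<close> strands each diagonal entry is known up to multiples of
  \<open>t^n\<close>. A positive weight contributes a further factor \<open>t\<close>, and weight
  \<open>0\<close> is exact, so the error is a multiple of \<open>t^(n + 1)\<close>.\<close>

lemma twist_trace:
  assumes w: "braid_word (Suc (Suc m)) w"
  shows "lsum (Suc (Suc m)) (\<lambda>xs. t_var ^ minuses xs *
      word_op t_half t_half (positive_word (twist_word m) @ w) (delta xs) xs) -
    t_var ^ negative_crossings w * (\<Sum>k\<le>Suc (Suc m). t_var ^ k) \<in> power_ideal (2 * Suc (Suc (Suc m)))"
proof -
  let ?n = "Suc (Suc m)" and ?l = "negative_crossings w"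
  let ?T = "gops t_half t_half (twist_word m)" and ?W = "word_op t_half t_half w"
  let ?d = "\<lambda>xs. delta (sorted_state ?n (minuses xs))"
  have "t_var ^ minuses xs * ?T (?W (delta xs)) xs -
      t_var ^ ?l * (t_var ^ minuses xs * ((- t_half) ^ inversions xs * ?T (?d xs) xs)) \<in> power_ideal (2 * Suc ?n)"
    if len: "length xs = ?n" for xs
  proof (cases "minuses xs = 0")
    case True
    then have "True \<notin> set xs"
      by (simp add: count_list_0_iff)
    then have "xs = replicate ?n False"
      using len by (intro replicate_eqI) auto
    moreover have "sorted_state ?n 0 = replicate ?n False"
      by (simp add: sorted_state_def)
    ultimately show ?thesis
      unfolding True
      by (simp only: gops_all_False word_op_all_False inversions_all_False) (simp add: delta_def power_ideal_0 t_var_eq)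
  next
    case False
    \<comment> \<open>First \<open>w\<close> is replaced by its scalar, then the basis vector by the
      sorted one of the same weight.\<close>
    let ?f = "\<lambda>ys. 1 * (?W (delta xs) ys - t_var ^ ?l * delta xs ys) +
        t_var ^ ?l * (delta xs ys - (- t_half) ^ inversions xs * ?d xs ys)"
    have "twist_small m ?f"
      by (rule twist_small_linear[OF twist_small_word[OF w delta_in_power_ideal] twist_small_delta[OF len]
            power_ideal_1 t_var_power_in_power_ideal]) simp
    then have small: "?T ?f xs \<in> power_ideal (2 * ?n)"
      using len unfolding twist_small_def by blast
    have "?T ?f xs = ?T (\<lambda>ys. 1 * ?W (delta xs) ys + (- (t_var ^ ?l * (- t_half) ^ inversions xs)) * ?d xs ys) xs"
      by (intro gops_cong) (simp add: right_diff_distrib)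
    also have "\<dots> = ?T (?W (delta xs)) xs - t_var ^ ?l * ((- t_half) ^ inversions xs * ?T (?d xs) xs)"
      unfolding gops_linear by simp
    finally have eq: "?T ?f xs = ?T (?W (delta xs)) xs - t_var ^ ?l * ((- t_half) ^ inversions xs * ?T (?d xs) xs)" .
    have "t_var ^ minuses xs \<in> power_ideal 2"
      using False by (intro t_var_power_in_power_ideal) simp
    then have "t_var ^ minuses xs * ?T ?f xs \<in> power_ideal (2 + 2 * ?n)"
      using small by (rule power_ideal_mult)
    from this[unfolded eq] show ?thesis
      unfolding right_diff_distrib mult.left_commute[of "t_var ^ minuses xs" "t_var ^ ?l"] by simp
  qed
  then have "lsum ?n (\<lambda>xs. t_var ^ minuses xs * ?T (?W (delta xs)) xs -
      t_var ^ ?l * (t_var ^ minuses xs * ((- t_half) ^ inversions xs * ?T (?d xs) xs))) \<in> power_ideal (2 * Suc ?n)"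
    by (intro lsum_closed power_ideal_0 power_ideal_add)
  then show ?thesis
    unfolding lsum_diff lsum_scale lsum_twist foldr_append word_op_positive o_apply .
qed

section \<open>Integer polynomials in \<open>t\<close> and division by powers of
  \<open>t\<close>\<close>

lemma eval_t_pCons: "eval_t (pCons a p) = of_int a + t_var * eval_t p"
  by (simp add: eval_t_def map_poly_pCons)

lemma eval_t_0: "eval_t 0 = 0"
  by (simp add: eval_t_def)

lemma eval_t_add: "eval_t (p + q) = eval_t p + eval_t q"
proof -
  have "map_poly of_int (p + q) = map_poly of_int p + (map_poly of_int q :: rat fls poly)"
    by (intro poly_eqI) (simp add: coeff_map_poly)
  then show ?thesis by (simp add: eval_t_def)
qed

lemma eval_t_uminus: "eval_t (- p) = - eval_t p"
proof -
  have "map_poly of_int (- p) = - (map_poly of_int p :: rat fls poly)"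
    by (intro poly_eqI) (simp add: coeff_map_poly)
  then show ?thesis by (simp add: eval_t_def)
qed

lemma eval_t_diff: "eval_t (p - q) = eval_t p - eval_t q"
  using eval_t_add[of p "- q"] by (simp only: eval_t_uminus add_uminus_conv_diff)

lemma eval_t_monom: "eval_t (monom 1 k) = t_var ^ k"
  by (induction k) (simp_all add: monom_0 monom_Suc eval_t_pCons eval_t_0)

lemma range_eval_t_add: "x \<in> range eval_t \<Longrightarrow> y \<in> range eval_t \<Longrightarrow> x + y \<in> range eval_t"
  by (auto simp flip: eval_t_add)

lemma range_eval_t_uminus: "x \<in> range eval_t \<Longrightarrow> - x \<in> range eval_t"
  by (auto simp flip: eval_t_uminus)

lemma range_eval_t_t_var: "x \<in> range eval_t \<Longrightarrow> t_var * x \<in> range eval_t"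
proof -
  assume "x \<in> range eval_t"
  then obtain p where "x = eval_t p" by blast
  then have "t_var * x = eval_t (pCons 0 p)"
    by (simp add: eval_t_pCons)
  then show ?thesis by simp
qed

lemma range_eval_t_t_var_power: "x \<in> range eval_t \<Longrightarrow> t_var ^ k * x \<in> range eval_t"
  by (induction k) (auto simp: mult.assoc intro: range_eval_t_t_var)

lemma range_eval_t_0: "0 \<in> range eval_t"
  using eval_t_0 by (metis rangeI)

lemma range_eval_t_1: "1 \<in> range eval_t"
  using eval_t_monom[of 0] by (metis power_0 rangeI)

lemma range_eval_t_diff: "x \<in> range eval_t \<Longrightarrow> y \<in> range eval_t \<Longrightarrow> x - y \<in> range eval_t"
  using range_eval_t_add[of x "- y"] range_eval_t_uminus by simp

lemma range_eval_t_sum: "(\<And>i. i \<in> A \<Longrightarrow> f i \<in> range eval_t) \<Longrightarrow> sum f A \<in> range eval_t"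
  by (induction A rule: infinite_finite_induct) (auto intro: range_eval_t_0 range_eval_t_add)

text \<open>In this model all matrix entries are integer polynomials in \<open>t\<close>.\<close>

lemma ptrace_in_range_eval_t: "ptrace t_var x n (word_op 1 t_var w) \<in> range eval_t"
  unfolding ptrace_def
proof (intro lsum_closed range_eval_t_0 range_eval_t_add range_eval_t_t_var_power)
  show "word_op 1 t_var w (delta ys) zs \<in> range eval_t" for ys zs
    by (rule word_op_closed) (auto intro: range_eval_t_add range_eval_t_uminus range_eval_t_t_var
        simp: delta_def range_eval_t_0 range_eval_t_1)
qed

lemma eval_t_in_power_ideal: "eval_t p \<in> power_ideal 0"
proof (induction p)
  case (pCons a p)
  have "(of_int a :: rat fls) \<in> power_ideal 0"
    using fps_to_fls_in_power_ideal[of "of_int a"] by simp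
  then show ?case
    unfolding eval_t_pCons using pCons t_var_power_in_power_ideal[of 0 1]
    by (intro power_ideal_add power_ideal_mult_0) simp_all
qed (simp add: eval_t_0 power_ideal_0)

lemma power_ideal_nth_0: "x \<in> power_ideal (Suc k) \<Longrightarrow> fls_nth x 0 = 0"
proof -
  assume "x \<in> power_ideal (Suc k)"
  then obtain f where "x = t_half ^ Suc k * fps_to_fls f"
    unfolding power_ideal_def by auto
  then have "x = fps_to_fls (fps_X ^ Suc k * f)"
    by (simp add: t_half_def fls_times_fps_to_fls fps_to_fls_power)
  then show ?thesis by simp
qed

lemma power_ideal_cancel:
  assumes "t_half ^ j * x \<in> power_ideal (j + k)"
  shows "x \<in> power_ideal k"
proof -
  obtain f where "t_half ^ j * x = t_half ^ j * (t_half ^ k * fps_to_fls f)"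
    using assms unfolding power_ideal_def by (auto simp: power_add mult.assoc)
  then show ?thesis
    unfolding power_ideal_def by simp
qed

text \<open>Vanishing constant terms split off one \<open>t\<close> at a time, so divisibility among
  rational power series yields an integer quotient.\<close>

lemma eval_t_divisible:
  "eval_t p \<in> power_ideal (2 * k) \<Longrightarrow> \<exists>q. eval_t p = t_var ^ k * eval_t q"
proof (induction k arbitrary: p)
  case (Suc k)
  obtain a r where p: "p = pCons a r"
    by (cases p)
  have "t_var * eval_t r \<in> power_ideal 2"
    using power_ideal_mult[OF t_var_power_in_power_ideal[of 2 1] eval_t_in_power_ideal] by simp
  then have "fls_nth (t_var * eval_t r) 0 = 0"
    using power_ideal_nth_0[of _ 1] by (simp add: numeral_2_eq_2)
  moreover have "fls_nth (eval_t p) 0 = 0"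
    using power_ideal_nth_0[of _ "Suc (2 * k)"] Suc.prems by simp
  ultimately have "a = 0"
    unfolding p eval_t_pCons by (simp add: fls_of_int_nth)
  then have "eval_t p = t_half ^ 2 * eval_t r"
    by (simp add: p eval_t_pCons t_var_def)
  then have "eval_t r \<in> power_ideal (2 * k)"
    using Suc.prems power_ideal_cancel[of 2 "eval_t r" "2 * k"] by simp
  then obtain q where "eval_t r = t_var ^ k * eval_t q"
    using Suc.IH by blast
  then show ?case
    using \<open>eval_t p = t_half ^ 2 * eval_t r\<close> by (auto simp: t_var_def mult.assoc)
qed (auto intro: exI[of _ p])

text \<open>The constant term of \<open>1 - t_var ^ 2\<close> is \<open>1\<close>, so its inverse is
  a power series.\<close>

lemma power_ideal_divide_unit:
  assumes "(1 - t_var ^ 2) * x \<in> power_ideal k"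
  shows "x \<in> power_ideal k"
proof -
  let ?u = "1 - fps_X ^ 4 :: rat fps"
  have u: "1 - t_var ^ 2 = fps_to_fls ?u"
    by (simp add: t_var_def t_half_def fps_to_fls_power flip: power_mult)
  have "subdegree ?u = 0"
    by (rule subdegree_eq_0) simp
  have "fps_to_fls (inverse ?u) \<in> power_ideal 0"
    by (rule fps_to_fls_in_power_ideal)
  then have "inverse (1 - t_var ^ 2) * ((1 - t_var ^ 2) * x) \<in> power_ideal k"
    using assms unfolding u fls_inverse_fps_to_fls[OF \<open>subdegree ?u = 0\<close>] by (rule power_ideal_mult_0)
  moreover have nonzero: "1 - t_var ^ 2 \<noteq> 0"
    using t_var_power_eq_one_iff[of 2] by simp
  ultimately show ?thesis
    unfolding mult.assoc[symmetric] left_inverse[OF nonzero] mult_1_left by simp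
qed

section \<open>From the trace to the formula for \<open>V\<close>\<close>

lemma full_twist_eq: "full_twist (Suc (Suc m)) = positive_word (twist_word m)"
proof -
  have "map Sigma [1..<Suc (Suc m)] = map Sigma (map Suc [0..<Suc m])"
    by (simp only: map_Suc_upt One_nat_def)
  also have "\<dots> = positive_word [0..<Suc m]"
    by (simp only: map_map comp_def)
  finally show ?thesis
    by (simp only: full_twist_def twist_word_def map_concat map_replicate)
qed

lemma length_full_twist: "length (full_twist n) = n * (n - 1)"
  by (simp add: full_twist_def length_concat sum_list_replicate)

lemma negative_crossings_full_twist: "negative_crossings (full_twist n @ w) = negative_crossings w"
proof -
  have "filter is_negative (full_twist n) = []"
    by (auto simp: full_twist_def filter_empty_conv)
  then show ?thesis by (simp add: negative_crossings_def)
qed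

text \<open>\<open>F\<close> is integral in the model \<open>a = 1\<close>,
  \<open>b = t_var\<close>, while the estimate comes from \<open>a = b = t_half\<close>; both
  compute the value of \<open>V\<close>. Multiplying by \<open>1 - t_var\<close> and dividing by the
  unit \<open>1 - t_var ^ 2\<close> turns the estimate for \<open>(1 + t_var) * F\<close> into one
  for \<open>F\<close>.\<close>

lemma jones_full_twist_trace:
  assumes V: "jones_polynomial V" and w: "braid_word (Suc (Suc m)) w"
    and l: "negative_crossings w = l" "l \<le> Suc (Suc m)"
  shows "\<exists>q. t_half ^ (4 * l) * (- t_half) ^ Suc m * V (braid_closure (Suc (Suc m)) (full_twist (Suc (Suc m)) @ w)) =
    (- t_half) ^ length (full_twist (Suc (Suc m)) @ w) *
    (t_var ^ l * ((\<Sum>i = 0..(Suc (Suc m) - l) div 2. t_var ^ (2 * i)) + t_var ^ (Suc (Suc m) - l + 1) * eval_t q))"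
proof -
  let ?n = "Suc (Suc m)"
  let ?W = "full_twist ?n @ w"
  let ?X = "t_half ^ (4 * l) * (- t_half) ^ Suc m * V (braid_closure ?n ?W)" and ?L = "length ?W"
  define F where "F = ptrace t_var False (Suc m) (word_op 1 t_var ?W)"
  have neg: "negative_crossings ?W = l"
    using l(1) by (simp only: negative_crossings_full_twist)
  have W: "braid_word ?n ?W"
    using w by (auto simp: full_twist_def braid_word_def)
  have X: "?X = (- t_half) ^ ?L * F"
    using jones_eq_ptrace[OF V _ W, of 1 t_var False] by (simp add: F_def neg)
  have "(- t_half) ^ ?L * ptrace t_var x (Suc m) (word_op t_half t_half ?W) = (- t_half) ^ ?L * (t_var ^ of_bool x * F)" for x
  proof -
    have "(- t_half) ^ ?L * ptrace t_var x (Suc m) (word_op t_half t_half ?W) = t_var ^ of_bool x * ?X"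
      unfolding jones_eq_ptrace[OF V t_var_eq[symmetric] W, symmetric] neg by (simp only: mult_ac)
    then show ?thesis
      unfolding X by (simp only: mult_ac)
  qed
  then have trace: "ptrace t_var x (Suc m) (word_op t_half t_half ?W) = t_var ^ of_bool x * F" for x
    by simp
  \<comment> \<open>Closing the first strand too adds its two states, with weights \<open>1\<close>
    and \<open>t\<close>.\<close>
  have "lsum ?n (\<lambda>xs. t_var ^ minuses xs * word_op t_half t_half ?W (delta xs) xs) = (1 + t_var) * F"
    using trace[of False] trace[of True] unfolding ptrace_def lsum.simps(2)[of "Suc m"] by (simp add: algebra_simps)
  then have sum: "(1 + t_var) * F - t_var ^ l * (\<Sum>k\<le>?n. t_var ^ k) \<in> power_ideal (2 * Suc ?n)"
    using twist_trace[OF w] by (simp only: l(1) full_twist_eq)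
  define M where "M = (?n - l) div 2"
  have geom1: "(1 - t_var) * (\<Sum>k\<le>?n. t_var ^ k) = 1 - t_var ^ Suc ?n"
    by (rule sum_gp_basic)
  have geom2: "(1 - t_var\<^sup>2) * (\<Sum>i = 0..M. t_var ^ (2 * i)) = 1 - t_var ^ (2 * Suc M)"
    using sum_gp_basic[of "t_var\<^sup>2" M] unfolding power_mult[symmetric] by (simp only: atMost_atLeast0)
  define S where "S = (\<Sum>i = 0..M. t_var ^ (2 * i))"
  \<comment> \<open>Both geometric sums telescope. The tails have exponents
    \<open>l + 2 * Suc M\<close> and \<open>l + Suc ?n\<close>, both at least \<open>Suc ?n\<close>
    by the choice of \<open>M\<close>.\<close>
  have "(1 - t_var\<^sup>2) * (F - t_var ^ l * S) =
      (1 - t_var) * ((1 + t_var) * F - t_var ^ l * (\<Sum>k\<le>?n. t_var ^ k)) +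
      (t_var ^ l * t_var ^ (2 * Suc M) - t_var ^ l * t_var ^ Suc ?n)"
  proof -
    have "(1 - t_var\<^sup>2) * (F - t_var ^ l * S) = (1 - t_var\<^sup>2) * F - t_var ^ l * (1 - t_var ^ (2 * Suc M))"
      unfolding geom2[folded S_def, symmetric] by (simp only: right_diff_distrib mult.left_commute)
    moreover have "(1 - t_var) * ((1 + t_var) * F - t_var ^ l * (\<Sum>k\<le>?n. t_var ^ k)) =
        (1 - t_var\<^sup>2) * F - t_var ^ l * (1 - t_var ^ Suc ?n)"
      unfolding geom1[symmetric] by (simp add: right_diff_distrib mult.left_commute power2_eq_square algebra_simps)
    ultimately show ?thesis
      by (simp only: right_diff_distrib) simp
  qed
  moreover have "\<dots> \<in> power_ideal (2 * Suc ?n)"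
  proof (rule power_ideal_add[OF power_ideal_mult_0[OF _ sum] power_ideal_diff])
    show "1 - t_var \<in> power_ideal 0"
      using power_ideal_diff[OF power_ideal_1 t_var_power_in_power_ideal[of 0 1]] by simp
    show "t_var ^ l * t_var ^ (2 * Suc M) \<in> power_ideal (2 * Suc ?n)"
      unfolding power_add[symmetric] using l(2) by (intro t_var_power_in_power_ideal) (simp add: M_def)
    show "t_var ^ l * t_var ^ Suc ?n \<in> power_ideal (2 * Suc ?n)"
      unfolding power_add[symmetric] by (intro t_var_power_in_power_ideal) simp
  qed
  ultimately have "(1 - t_var\<^sup>2) * (F - t_var ^ l * S) \<in> power_ideal (2 * Suc ?n)"
    by (rule ssubst)
  then have ideal: "F - t_var ^ l * S \<in> power_ideal (2 * Suc ?n)"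
    by (rule power_ideal_divide_unit)
  have "t_var ^ k \<in> range eval_t" for k
    using rangeI[of eval_t "monom 1 k"] unfolding eval_t_monom .
  then have "F - t_var ^ l * S \<in> range eval_t"
    unfolding F_def S_def
    by (intro range_eval_t_diff ptrace_in_range_eval_t range_eval_t_t_var_power range_eval_t_sum)
  then obtain p where p: "F - t_var ^ l * S = eval_t p"
    by blast
  obtain q where "eval_t p = t_var ^ Suc ?n * eval_t q"
    using eval_t_divisible[OF ideal[unfolded p]] by blast
  \<comment> \<open>The truncated difference is exact because \<open>l\<close> is at most the number
    of strands.\<close>
  moreover have "t_var ^ Suc ?n = t_var ^ l * t_var ^ (?n - l + 1)"
    unfolding power_add[symmetric] by (rule arg_cong[where f = "(^) t_var"]) (use l(2) in simp)
  ultimately have F: "F = t_var ^ l * (S + t_var ^ (?n - l + 1) * eval_t q)"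
    unfolding distrib_left mult.assoc[symmetric] using p by (metis add.commute diff_add_cancel)
  show ?thesis
    unfolding X by (rule exI[of _ q]) (simp only: F S_def M_def)
qed

lemma jones_full_twist:
  assumes V: "jones_polynomial V" and n: "n \<ge> 1" and w: "braid_word n w"
    and c: "length w = c" and l: "negative_crossings w = l" "l \<le> n"
  shows "\<exists>q. V (braid_closure n (full_twist n @ w)) =
      (-1) ^ (n + c + 1) * t_half powi ((int n - 1)\<^sup>2 + int c - 2 * int l) *
      ((\<Sum>i = 0..(n - l) div 2. t_var ^ (2 * i)) + t_var ^ (n - l + 1) * eval_t q)"
proof (cases "n = 1")
  case True
  \<comment> \<open>A single strand has no crossings and its closure is the unknot, so the bracket
    is \<open>1\<close> with \<open>q = 0\<close>. \<open>twist_word\<close> starts at two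
    strands.\<close>
  then have "w = []"
    using w by (cases w) auto
  then show ?thesis
    using True c l jones_closure_one[OF V]
    by (auto simp: full_twist_def negative_crossings_def eval_t_0 intro!: exI[of _ 0])
next
  case False
  then obtain m where m: "n = Suc (Suc m)"
    using n by (cases n; cases "n - 1") auto
  let ?V = "V (braid_closure n (full_twist n @ w))"
  obtain q where q: "t_half ^ (4 * l) * (- t_half) ^ Suc m * ?V = (- t_half) ^ length (full_twist n @ w) *
      (t_var ^ l * ((\<Sum>i = 0..(n - l) div 2. t_var ^ (2 * i)) + t_var ^ (n - l + 1) * eval_t q))"
    using jones_full_twist_trace[OF V w[unfolded m] l(1) l(2)[unfolded m]] unfolding m by blast
  let ?P = "(-1) ^ (n + c + 1) * t_half powi ((int n - 1)\<^sup>2 + int c - 2 * int l)"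
  let ?K = "t_half ^ (4 * l) * (- t_half) ^ Suc m"
  have sign: "(- t_half) ^ k = (- 1) ^ k * t_half ^ k" for k
    by (rule power_minus)
  \<comment> \<open>The exponents of \<open>t_half\<close> add up to
    \<open>n (n - 1) + c + 2 l\<close>: the length of the whole word, and
    \<open>t^l\<close>.\<close>
  have "?K * ?P = ((-1) ^ Suc m * (-1) ^ (n + c + 1)) *
      (t_half powi int (4 * l + Suc m) * t_half powi ((int n - 1)\<^sup>2 + int c - 2 * int l))"
    unfolding sign power_int_of_nat power_add by (simp only: mult_ac)
  also have "t_half powi int (4 * l + Suc m) * t_half powi ((int n - 1)\<^sup>2 + int c - 2 * int l) =
      t_half powi int (Suc m * n + c + 2 * l)"
    unfolding power_int_add[OF disjI1[OF t_half_nonzero], symmetric]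
    by (rule arg_cong[where f = "(powi) t_half"]) (simp add: m power2_eq_square algebra_simps)
  also have "((-1) ^ Suc m * (-1) ^ (n + c + 1) :: rat fls) = (-1) ^ (Suc m * n + c)"
    unfolding power_add[symmetric] minus_one_power_iff m by (cases "even m"; cases "even c") simp_all
  also have "(-1) ^ (Suc m * n + c) * t_half powi int (Suc m * n + c + 2 * l) =
      (- t_half) ^ length (full_twist n @ w) * t_var ^ l"
  proof -
    have "length (full_twist n @ w) = Suc m * n + c"
      by (simp add: length_full_twist c m)
    then show ?thesis
      unfolding sign power_int_of_nat t_var_power by (simp only: power_add mult.assoc)
  qed
  finally have "?K * (?P * x) = (- t_half) ^ length (full_twist n @ w) * (t_var ^ l * x)" for x
    by (simp only: mult.assoc[symmetric])
  then have eq: "?K * ?V = ?K * (?P * ((\<Sum>i = 0..(n - l) div 2. t_var ^ (2 * i)) + t_var ^ (n - l + 1) * eval_t q))"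
    unfolding q by (rule sym)
  have "?K \<noteq> 0" by simp
  then show ?thesis
    by (intro exI[of _ q]) (rule iffD1[OF mult_left_cancel eq])
qed

theorem theorem1:
  fixes V :: "slice list \<Rightarrow> rat fls"
    and n c l :: nat
    and w :: "braid_letter list"
  assumes "jones_polynomial V"
    and "n \<ge> 1"
    and "braid_word n w"
    and "length w = c"
    and "negative_crossings w = l"
    and "l \<le> n"
  shows "\<exists>p q :: int poly.
    V (braid_closure n (full_twist n @ w)) =
      (-1) ^ (n + c + 1) * t_half powi ((int n - 1)\<^sup>2 + int c - 2 * int l) *
      ((1 + t_var ^ (n - l + 1) * eval_t p) / (1 - t_var ^ 2)) \<and>
    V (braid_closure n (full_twist n @ w)) =
      (-1) ^ (n + c + 1) * t_half powi ((int n - 1)\<^sup>2 + int c - 2 * int l) *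
      ((\<Sum>i = 0..(n - l) div 2. t_var ^ (2 * i)) + t_var ^ (n - l + 1) * eval_t q)"
proof -
  obtain q where q: "V (braid_closure n (full_twist n @ w)) =
      (-1) ^ (n + c + 1) * t_half powi ((int n - 1)\<^sup>2 + int c - 2 * int l) *
      ((\<Sum>i = 0..(n - l) div 2. t_var ^ (2 * i)) + t_var ^ (n - l + 1) * eval_t q)"
    using jones_full_twist[OF assms] by blast
  define M where "M = (n - l) div 2"
  \<comment> \<open>The first even exponent beyond the sum is \<open>n - l + 1 + d\<close>, where
    \<open>d\<close> is \<open>1\<close> for even \<open>n - l\<close> and \<open>0\<close> for odd
    \<open>n - l\<close>.\<close>
  define d where "d = 2 * Suc M - (n - l + 1)"
  \<comment> \<open>Multiplying the second formula by \<open>1 - t^2\<close> gives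
    \<open>p = (1 - t^2) q - t^d\<close>; the two \<open>pCons 0\<close> multiply \<open>q\<close>
    by \<open>t^2\<close>.\<close>
  define p where "p = q - pCons 0 (pCons 0 q) - monom 1 d"
  have d: "2 * Suc M = n - l + 1 + d"
    by (simp add: d_def M_def)
  have p: "eval_t p = (1 - t_var\<^sup>2) * eval_t q - t_var ^ d"
    by (simp only: p_def eval_t_diff eval_t_monom eval_t_pCons)
      (simp add: power2_eq_square algebra_simps)
  have "(1 - t_var\<^sup>2) * (\<Sum>i = 0..M. t_var ^ (2 * i)) = 1 - t_var ^ (n - l + 1) * t_var ^ d"
    using sum_gp_basic[of "t_var\<^sup>2" M] unfolding power_mult[symmetric] d[symmetric] power_add[symmetric]
    by (simp only: atMost_atLeast0)
  then have "1 + t_var ^ (n - l + 1) * eval_t p =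
      (1 - t_var\<^sup>2) * ((\<Sum>i = 0..M. t_var ^ (2 * i)) + t_var ^ (n - l + 1) * eval_t q)"
    unfolding p distrib_left by (simp add: algebra_simps)
  moreover have "1 - t_var\<^sup>2 \<noteq> 0"
    using t_var_power_eq_one_iff[of 2] by simp
  ultimately have "(1 + t_var ^ (n - l + 1) * eval_t p) / (1 - t_var\<^sup>2) =
      (\<Sum>i = 0..M. t_var ^ (2 * i)) + t_var ^ (n - l + 1) * eval_t q"
    by simp
  then show ?thesis
    using q unfolding M_def by metis
qed

end
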